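(* Let $E \subset \mathbb{R}$ be a nonempty set. Then the following are equivalent: (a) There exist $1<p<\infty$ and $\alpha>0$ such that $d_E^{\,-\alpha} \in A_p^+$. (b) For every $1<p<\infty$, there exists $\alpha>0$ such that $d_E^{\,-\alpha} \in A_p^+$. (c) $E$ is $(s,t)$-right median porous for some $0<s<t<1$. (d) $E$ is $(s,t)$-right median porous for all $0<s<t<1$.
   Context: Lebesgue measure on $\mathbb{R}$ is denoted $|\cdot|$. Throughout, $I=(a,b)$ with $a<b$ real denotes a bounded open interval; $I^-=(a,\frac{a+b}{2})$ and $I^+=(\frac{a+b}{2},b)$ are its left and right halves. $\frac{1}{|J|}\int_J$ is the average over an interval $J$. Distance function: $d_E(x)=\inf\{|x-y|:y\in E\}$; $d_E^{\,-\alpha}(x)=d_E(x)^{-\alpha}$, which equals $+\infty$ where $d_E(x)=0$. Weights: a weight on $\mathbb{R}$ is a function $w:\mathbb{R}\to[0,\infty]$ which is locally integrable and satisfies $w>0$ a.e. For $1<p<\infty$, a weight $w$ belongs to $A_p^+$ if $$\sup_{I\subset\mathbb{R}}\Big(\frac{1}{|I^-|}\int_{I^-}w\Big)\Big(\frac{1}{|I^+|}\int_{I^+}w^{-1/(p-1)}\Big)^{p-1}<\infty.$$ The statement $d_E^{\,-\alpha}\in A_p^+$ includes the assertion that $d_E^{\,-\alpha}$ is a weight. Pore lengths: for $E\subset\mathbb{R}$, $0<s\le1$ and an open interval $I$, $L_s(E,I)$ is the supremum of all $\ell>0$ for which there exist an integer $k\ge1$ and disjoint open intervals $I_1,\dots,I_k\subset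 I\setminus E$ with $|I_i|\ge\ell$ for all $i$ and $\sum_{i=1}^k|I_i|\ge(1-s)|I|$; if no such $\ell$ exists, $L_s(E,I)=0$. Right median porosity: for $0<s<t<1$ and $0<\delta<1$, $E$ is $(s,t,\delta)$-right median porous if for every bounded open interval $I\subset\mathbb{R}$ there exist finitely many disjoint open intervals $I_1,\dots,I_k\subset I^-\setminus E$ such that $|I_i|\ge\delta L_t(E,I^+)$ for all $i$ and $\sum_{i=1}^k|I_i|\ge(1-s)|I^-|$. $E$ is $(s,t)$-right median porous if it is $(s,t,\delta)$-right median porous for some $0<\delta<1$. *)

theory Defs
  imports "HOL-Analysis.Analysis"
begin

text \<open>
  Real powers on \<open>[0,\<infinity>]\<close> with \<open>0 powr r = \<infinity>\<close> and \<open>\<infinity> powr r = 0\<close> for \<open>r < 0\<close>; the library's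
  \<open>powr\<close> on the reals has \<open>0 powr r = 0\<close> for every \<open>r\<close>.
\<close>
definition enn_powr :: "ennreal \<Rightarrow> real \<Rightarrow> ennreal" where
  "enn_powr x r =
     (if r = 0 then 1
      else if x = 0 then (if r < 0 then \<infinity> else 0)
      else if x = \<infinity> then (if r < 0 then 0 else \<infinity>)
      else ennreal (enn2real x powr r))"

definition dist_powr :: "real set \<Rightarrow> real \<Rightarrow> real \<Rightarrow> ennreal" where
  "dist_powr E r x = enn_powr (ennreal (infdist x E)) r"

definition weight :: "(real \<Rightarrow> ennreal) \<Rightarrow> bool" where
  "weight w \<longleftrightarrow>
     w \<in> borel_measurable lebesgue \<and>
     (\<forall>K. compact K \<longrightarrow> (\<integral>\<^sup>+x\<in>K. w x \<partial>lebesgue) < \<infinity>) \<and>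
     (AE x in lebesgue. w x > 0)"

definition average :: "real set \<Rightarrow> (real \<Rightarrow> ennreal) \<Rightarrow> ennreal" where
  "average J f = (\<integral>\<^sup>+x\<in>J. f x \<partial>lebesgue) / emeasure lebesgue J"

text \<open>
  For a weight \<open>w\<close>, both averages below are positive and the first one is finite, so the
  convention \<open>0 * \<infinity> = 0\<close> never comes into play.
\<close>
definition Ap_plus :: "real \<Rightarrow> (real \<Rightarrow> ennreal) set" where
  "Ap_plus p = {w. weight w \<and>
     (SUP (a, b) \<in> {(a, b). a < b}.
        average {a <..< (a + b) / 2} w *
        enn_powr (average {(a + b) / 2 <..< b} (\<lambda>x. enn_powr (w x) (- 1 / (p - 1)))) (p - 1))
     < \<infinity>}"

text \<open>
  \<open>has_pores E J l m\<close>: there are finitely many (at least one) disjoint nonempty open intervals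
  in \<open>J - E\<close>, each of length at least \<open>l\<close> and of total length at least \<open>m\<close>.
\<close>
definition has_pores :: "real set \<Rightarrow> real set \<Rightarrow> real \<Rightarrow> real \<Rightarrow> bool" where
  "has_pores E J l m \<longleftrightarrow>
     (\<exists>(k::nat) u v. k \<ge> 1 \<and>
        (\<forall>i<k. u i < v i \<and> {u i <..< v i} \<subseteq> J - E \<and> v i - u i \<ge> l) \<and>
        disjoint_family_on (\<lambda>i. {u i <..< v i}) {..<k} \<and>
        (\<Sum>i<k. v i - u i) \<ge> m)"

text \<open>
  The pore length of \<open>E\<close> in \<open>(a,b)\<close>. The set of admissible \<open>l\<close> is bounded above by \<open>b - a\<close>,
  so \<open>Sup\<close> is a genuine supremum.
\<close>
definition pore_length :: "real \<Rightarrow> real set \<Rightarrow> real \<Rightarrow> real \<Rightarrow> real" where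
  "pore_length s E a b =
     (let S = {l. l > 0 \<and> has_pores E {a <..< b} l ((1 - s) * (b - a))}
      in if S = {} then 0 else Sup S)"

definition right_median_porous_const :: "real \<Rightarrow> real \<Rightarrow> real \<Rightarrow> real set \<Rightarrow> bool" where
  "right_median_porous_const s t \<delta> E \<longleftrightarrow>
     (\<forall>a b. a < b \<longrightarrow>
        has_pores E {a <..< (a + b) / 2} (\<delta> * pore_length t E ((a + b) / 2) b)
          ((1 - s) * ((a + b) / 2 - a)))"

definition right_median_porous :: "real \<Rightarrow> real \<Rightarrow> real set \<Rightarrow> bool" where
  "right_median_porous s t E \<longleftrightarrow> (\<exists>\<delta>. 0 < \<delta> \<and> \<delta> < 1 \<and> right_median_porous_const s t \<delta> E)"

end

theory Submission
  imports Defs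
begin

text \<open>
  Write \<open>d = infdist \<cdot> E\<close>. The implications (d) to (c) and (b) to (a) are instances, so the work lies in
  (a) to (d) and in (c) to (b).

  (a) to (d). A large pore length \<open>l\<close> in the right half makes the average of \<open>d\<close> to the power
  \<open>\<alpha> / (p - 1)\<close> over that half at least a constant times \<open>l\<close> to that power. The \<open>A\<^sub>p\<^sup>+\<close> bound then
  limits the average of the weight over the left half, and Chebyshev's inequality leaves \<open>d < \<epsilon> l\<close>
  only on a fraction \<open>s\<close> of it. Points with \<open>d \<ge> \<epsilon> l\<close> lie in pores of length at least \<open>\<epsilon> l\<close>
  (\<open>has_pores_if_mass_far\<close>). The result is \<open>right_median_porous_if_Ap_plus\<close>, for all \<open>s\<close> and \<open>t\<close> in
  \<open>(0,1)\<close>.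

  (c) to (b). This is a one-sided John--Nirenberg theorem for \<open>- ln d\<close>. Porosity says that the relative
  measure of small distances passes from right to left with a gain: for some \<open>s < \<sigma> < \<tau> = t\<close> and
  \<open>c > 0\<close>, if \<open>d < \<rho>\<close> on at most a fraction \<open>\<tau>\<close> of \<open>(v, v + r)\<close>, then \<open>d < c \<rho>\<close> on at most a
  fraction \<open>\<sigma>\<close> of \<open>(v - r, v)\<close> (\<open>mass_infdist_transfer\<close>). The strict inequality \<open>\<sigma> < \<tau>\<close> is what makes
  iteration possible. Let \<open>A n\<close> be the open set \<open>d < \<rho> (c / 2)\<^sup>n\<close>. A rising sun construction splits
  \<open>A n\<close> into intervals on which it has density at least \<open>\<tau>\<close> and to the right of which it has density
  at most \<open>\<tau>\<close> at all relevant scales; on each of them \<open>A (n + 1)\<close> has density at most \<open>\<sigma>\<close>, so that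
  its measure is at most \<open>\<sigma> / \<tau>\<close> times that of \<open>A n\<close> (\<open>rising_sun_step\<close>). Iterating, and
  then moving to the left in steps that enlarge the interval by the factor \<open>3 / 2\<close>, one obtains
  exponential decay on long intervals to the left of any interval on which \<open>A 0\<close> has density at
  most \<open>\<tau>\<close> (\<open>decay_left\<close>, \<open>exists_decay_shift\<close>). The locale \<open>porous_cascade\<close> isolates what this argument
  needs. Taking complements and reflecting the line turns the transfer property into one of the same
  form for the sets \<open>d > \<rho> (2 / c)\<^sup>n\<close>, so that large distances decay exponentially to the right
  (\<open>porous_cascade_far\<close>).

  To bound the product of averages for the halves \<open>(v - h, v)\<close> and \<open>(v, v + h)\<close>, split the left half into
  the dyadic pieces \<open>(v - h / 2\<^sup>l, v - h / 2\<^sup>l\<^sup>+\<^sup>1)\<close>. Between each piece and \<open>v\<close> there is an interval \<open>J\<close>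
  of comparable length and a number \<open>\<rho>\<close> which is, up to the factor 2, the \<open>\<tau>\<close>-quantile of \<open>d\<close> on \<open>J\<close>
  (\<open>exists_quantile\<close>). By decay to the left, the integral of the weight over the piece is at most a
  constant times \<open>\<rho>\<close> to the power \<open>-\<alpha>\<close> times the length of the piece (\<open>near_integral\<close>). By decay to
  the right, the dual average over the whole of \<open>(v, v + h)\<close> contributes at most \<open>\<rho>\<close> to the power
  \<open>\<alpha>\<close>, times a factor that grows geometrically in \<open>l\<close> since \<open>J\<close> is much shorter than \<open>(v, v + h)\<close>
  (\<open>far_integral\<close>). The powers of \<open>\<rho>\<close> cancel. For small \<open>\<alpha>\<close> the geometric growth is at most
  that of \<open>(3 / 2)\<^sup>l\<close>, while the lengths of the pieces decrease like \<open>(1 / 2)\<^sup>l\<close>, so the sum over \<open>l\<close> converges.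
\<close>

section \<open>Lebesgue measure of the part of a set in an interval\<close>

definition mass :: "real set \<Rightarrow> real \<Rightarrow> real \<Rightarrow> real" where
  "mass A u v = measure lebesgue (A \<inter> {u<..<v})"

lemma lmeasurable_Int_greaterThanLessThan [simp, intro]:
  "A \<in> sets lebesgue \<Longrightarrow> A \<inter> {u<..<v::real} \<in> lmeasurable"
  by (rule bounded_set_imp_lmeasurable) (auto intro: bounded_subset[of "{u<..<v}"])

lemma mass_nonneg [simp]: "0 \<le> mass A u v"
  by (simp add: mass_def)

lemma mass_empty [simp]: "v \<le> u \<Longrightarrow> mass A u v = 0"
  by (simp add: mass_def)

lemma mass_mono:
  assumes "A \<inter> {u<..<v} \<subseteq> B" "u' \<le> u" "v \<le> v'" "A \<in> sets lebesgue" "B \<in> sets lebesgue"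
  shows "mass A u v \<le> mass B u' v'"
  unfolding mass_def by (rule measure_mono_fmeasurable) (use assms in auto)

lemma mass_le_length:
  assumes "A \<in> sets lebesgue" "u \<le> v"
  shows "mass A u v \<le> v - u"
proof -
  have "mass A u v \<le> mass UNIV u v"
    by (rule mass_mono) (use assms in auto)
  then show ?thesis using assms by (simp add: mass_def)
qed

lemma mass_full:
  assumes "{u<..<v} \<subseteq> A" "u \<le> v"
  shows "mass A u v = v - u"
proof -
  have "A \<inter> {u<..<v} = {u<..<v}" using assms by auto
  then show ?thesis using assms by (simp add: mass_def)
qed

lemma mass_split:
  assumes A: "A \<in> sets lebesgue" and "u \<le> x" "x \<le> v"
  shows "mass A u v = mass A u x + mass A x v"
proof -
  have "measure lebesgue (A \<inter> {u<..<v}) =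
      measure lebesgue ((A \<inter> {u<..<x}) \<union> (A \<inter> {x<..<v}))"
  proof (rule measure_eq_AE)
    have "AE y in lebesgue. y \<noteq> x"
      by (rule AE_I[where N="{x}"]) auto
    then show "AE y in lebesgue. (y \<in> A \<inter> {u<..<v}) =
        (y \<in> A \<inter> {u<..<x} \<union> A \<inter> {x<..<v})"
      by eventually_elim (use assms in auto)
  qed (use A in \<open>auto intro!: sets.Un sets.Int\<close>)
  also have "\<dots> = measure lebesgue (A \<inter> {u<..<x}) + measure lebesgue (A \<inter> {x<..<v})"
  proof -
    have "A \<inter> {u<..<x} \<inter> (A \<inter> {x<..<v}) = {}" by auto
    then show ?thesis using A by (subst measure_Un3) auto
  qed
  finally show ?thesis by (simp add: mass_def)
qed

lemma mass_compl:
  assumes A: "A \<in> sets lebesgue" and "u \<le> v"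
  shows "mass (- A) u v = (v - u) - mass A u v"
proof -
  have "measure lebesgue ((- A \<inter> {u<..<v}) \<union> (A \<inter> {u<..<v})) = mass (- A) u v + mass A u v"
  proof -
    have "(- A \<inter> {u<..<v}) \<inter> (A \<inter> {u<..<v}) = {}" by auto
    then show ?thesis unfolding mass_def using A
      by (subst measure_Un3) (auto simp: Compl_in_sets_lebesgue)
  qed
  moreover have "(- A \<inter> {u<..<v}) \<union> (A \<inter> {u<..<v}) = {u<..<v}" by auto
  ultimately show ?thesis using assms by simp
qed

lemma continuous_on_mass:
  assumes A: "A \<in> sets lebesgue"
  shows "continuous_on {u..v} (mass A u)"
proof -
  have *: "\<bar>mass A u x - mass A u y\<bar> \<le> \<bar>x - y\<bar>" if "u \<le> x" "u \<le> y" "x \<le> y" for x y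
    using mass_split[OF A, of u x y] mass_le_length[OF A, of x y] mass_nonneg[of A x y] that by linarith
  have "1-lipschitz_on {u..v} (mass A u)"
  proof (rule lipschitz_onI)
    fix x y assume "x \<in> {u..v}" "y \<in> {u..v}"
    then show "dist (mass A u x) (mass A u y) \<le> 1 * dist x y"
      using *[of x y] *[of y x] by (cases "x \<le> y") (auto simp: dist_real_def abs_minus_commute)
  qed simp
  then show ?thesis by (rule lipschitz_on_continuous_on)
qed

section \<open>A one-sided rising sun argument\<close>

text \<open>
  A maximum point of \<open>y \<mapsto> mass A u y - \<tau> (y - u)\<close> on \<open>[u, v]\<close> has density at least \<open>\<tau>\<close> on its left,
  from \<open>u\<close> on, and density at most \<open>\<tau>\<close> on its right, up to \<open>v\<close>.
\<close>

lemma exists_right_sparse_point: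
  assumes A: "A \<in> sets lebesgue" and "u \<le> v"
  obtains z where "u \<le> z" "z \<le> v" "\<tau> * (z - u) \<le> mass A u z"
    "\<And>y. z \<le> y \<Longrightarrow> y \<le> v \<Longrightarrow> mass A z y \<le> \<tau> * (y - z)"
proof -
  have "continuous_on {u..v} (\<lambda>y. mass A u y - \<tau> * (y - u))"
    by (intro continuous_intros continuous_on_mass A)
  then obtain z where z: "z \<in> {u..v}"
    and max: "\<And>y. y \<in> {u..v} \<Longrightarrow> mass A u y - \<tau> * (y - u) \<le> mass A u z - \<tau> * (z - u)"
    using continuous_attains_sup[of "{u..v}" "\<lambda>y. mass A u y - \<tau> * (y - u)"] \<open>u \<le> v\<close> by auto
  show thesis
  proof
    show "u \<le> z" "z \<le> v" using z by auto
    show "\<tau> * (z - u) \<le> mass A u z" using max[of u] \<open>u \<le> v\<close> by simp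
    show "mass A z y \<le> \<tau> * (y - z)" if "z \<le> y" "y \<le> v" for y
      using max[of y] mass_split[OF A, of u z y] z that by (simp add: algebra_simps)
  qed
qed

text \<open>
  Instead of decomposing \<open>A\<close> into rising sun intervals, the proof moves the endpoint \<open>x\<close> of the claimed
  inequality on \<open>(a, x)\<close> from \<open>a\<close> to \<open>b\<close> by continuous induction. Away from \<open>closure B\<close> the left-hand
  side does not grow. At a point of \<open>closure B\<close>, hence of the open set \<open>A\<close>, one can advance to the
  next right-sparse point \<open>z\<close>, because the density of \<open>A\<close> just after \<open>x\<close> is \<open>1 > \<tau>\<close>. Between \<open>x\<close> and
  \<open>z\<close> the density of \<open>A\<close> is at least \<open>\<tau>\<close>, whereas that of \<open>B\<close> is at most \<open>\<sigma>\<close> by the transfer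
  hypothesis, applied to the interval of the same length to the right of \<open>z\<close>. That interval may
  extend past \<open>b\<close>, but not past \<open>2 * b - a\<close>; there the sparseness at \<open>b\<close> takes over.
\<close>

lemma rising_sun_step:
  assumes A: "open A" and B: "B \<in> sets lebesgue" "closure B \<subseteq> A"
    and \<tau>: "0 < \<tau>" "\<tau> < 1"
    and step: "\<And>v r. 0 < r \<Longrightarrow> mass A v (v + r) \<le> \<tau> * r \<Longrightarrow> mass B (v - r) v \<le> \<sigma> * r"
    and ab: "a \<le> b"
    and sparse: "\<And>y. b \<le> y \<Longrightarrow> y \<le> 2 * b - a \<Longrightarrow> mass A b y \<le> \<tau> * (y - b)"
    and "0 \<le> \<sigma>"
  shows "mass B a b \<le> \<sigma> / \<tau> * mass A a b"
proof -
  have Am: "A \<in> sets lebesgue" using A by (simp add: borel_open sets_completionI_sets)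
  \<comment> \<open>As this set is closed, it suffices to exceed its supremum whenever that is below \<open>b\<close>.\<close>
  define T where "T = {x \<in> {a..b}. mass B a x \<le> \<sigma> / \<tau> * mass A a x}"
  have "closed T" unfolding T_def
    by (intro continuous_on_closed_Collect_le continuous_intros continuous_on_mass Am B closed_atLeastAtMost)
  moreover have "a \<in> T" using ab by (simp add: T_def)
  moreover have bdd: "bdd_above T" by (auto simp: T_def)
  ultimately have sT: "Sup T \<in> T" by (intro closed_contains_Sup) auto
  have T_step: False
    if y: "Sup T < y" "y \<le> b" and le: "mass B (Sup T) y \<le> \<sigma> / \<tau> * mass A (Sup T) y" for y
  proof -
    have "mass B a y \<le> \<sigma> / \<tau> * mass A a y"
      using mass_split[OF B(1), of a "Sup T" y] mass_split[OF Am, of a "Sup T" y] sT y le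
      by (simp add: T_def algebra_simps)
    then have "y \<in> T" using sT y by (simp add: T_def)
    then show False using cSup_upper[OF _ bdd, of y] y by simp
  qed
  have "\<not> Sup T < b"
  proof
    assume lt: "Sup T < b"
    have ge: "a \<le> Sup T" using sT by (simp add: T_def)
    show False
    proof (cases "Sup T \<in> closure B")
      case False
      then obtain e where e: "0 < e" "ball (Sup T) e \<subseteq> - closure B"
        by (metis Compl_iff open_Compl closed_closure open_contains_ball)
      define y where "y = min b (Sup T + e / 2)"
      have "B \<inter> {Sup T<..<y} = {}"
      proof -
        have False if "x \<in> B" "Sup T < x" "x < y" for x
        proof -
          have "x \<in> ball (Sup T) e" using that e by (simp add: y_def dist_real_def)
          then show False using e that closure_subset by blast
        qed
        then show ?thesis by auto
      qed
      then have "mass B (Sup T) y = 0" by (simp add: mass_def)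
      then show False
        using T_step[of y] lt e \<open>0 \<le> \<sigma>\<close> \<tau> by (simp add: y_def)
    next
      case True
      then have "Sup T \<in> A" using B by blast
      then obtain e where e: "0 < e" "ball (Sup T) e \<subseteq> A"
        using A open_contains_ball by blast
      obtain z where z: "Sup T \<le> z" "z \<le> b" "\<tau> * (z - Sup T) \<le> mass A (Sup T) z"
        and zs: "\<And>y. z \<le> y \<Longrightarrow> y \<le> b \<Longrightarrow> mass A z y \<le> \<tau> * (y - z)"
        using exists_right_sparse_point[OF Am, of "Sup T" b \<tau>] lt by auto
      have "z \<noteq> Sup T"
      proof
        assume eq: "z = Sup T"
        define y where "y = min b (Sup T + e)"
        have y: "Sup T < y" "y \<le> b" "{Sup T<..<y} \<subseteq> A"
          using e lt by (auto simp: y_def dist_real_def subset_iff)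
        have "y - Sup T \<le> \<tau> * (y - Sup T)"
          using zs[of y] mass_full[of "Sup T" y A] y eq by simp
        then show False using \<tau> y by simp
      qed
      define r where "r = z - Sup T"
      have r: "0 < r" using z \<open>z \<noteq> Sup T\<close> by (simp add: r_def)
      have "mass A z (z + r) \<le> \<tau> * r"
      proof (cases "z + r \<le> b")
        case True
        then show ?thesis using zs[of "z + r"] r by simp
      next
        case False
        then have "mass A z (z + r) = mass A z b + mass A b (z + r)"
          using mass_split[OF Am, of z b "z + r"] z by simp
        also have "\<dots> \<le> \<tau> * (b - z) + \<tau> * (z + r - b)"
          using zs[of b] sparse[of "z + r"] False z ge by (intro add_mono) (auto simp: r_def)
        finally show ?thesis by (simp add: algebra_simps)
      qed
      from step[OF r this] have "mass B (Sup T) z \<le> \<sigma> * r" by (simp add: r_def)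
      also have "\<dots> = \<sigma> / \<tau> * (\<tau> * r)" using \<tau> by simp
      also have "\<dots> \<le> \<sigma> / \<tau> * mass A (Sup T) z"
        using z \<tau> \<open>0 \<le> \<sigma>\<close> by (intro mult_left_mono) (auto simp: r_def)
      finally show False using T_step[of z] r z by (simp add: r_def)
    qed
  qed
  then have "Sup T = b" using sT by (simp add: T_def)
  then show ?thesis using sT by (simp add: T_def)
qed

section \<open>Geometric decay along a cascade of open sets\<close>

text \<open>
  Both the sets of small distances and, after reflection, the sets of large distances to a porous set
  form such a cascade. The inclusion of the closure gives the room that \<open>rising_sun_step\<close> needs.
\<close>

locale porous_cascade =
  fixes A :: "nat \<Rightarrow> real set" and \<sigma> \<tau> :: real
  assumes open_level: "open (A n)"
    and closure_level: "closure (A (Suc n)) \<subseteq> A n"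
    and level_step: "0 < r \<Longrightarrow> mass (A n) v (v + r) \<le> \<tau> * r \<Longrightarrow> mass (A (Suc n)) (v - r) v \<le> \<sigma> * r"
    and thresholds: "0 < \<sigma>" "\<sigma> < \<tau>" "\<tau> < 1"
begin

abbreviation "\<theta> \<equiv> \<sigma> / \<tau>"

lemma ratio: "0 < \<theta>" "\<theta> < 1"
  using thresholds by auto

lemma level_sets [simp]: "A n \<in> sets lebesgue"
  using open_level[of n] by (simp add: borel_open)

lemma level_antimono: "m \<le> n \<Longrightarrow> A n \<subseteq> A m"
  by (rule lift_Suc_antimono_le) (use closure_level closure_subset in blast)+

lemma mass_level_antimono: "m \<le> n \<Longrightarrow> mass (A n) u v \<le> mass (A m) u v"
  by (rule mass_mono) (use level_antimono in auto)

text \<open>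
  A point that is right-sparse for level \<open>k\<close> is right-sparse for all later levels, so
  \<open>rising_sun_step\<close> can be iterated at the same point.
\<close>

lemma decay_left_of_sparse_point:
  assumes "a \<le> b" and sparse: "\<And>y. b \<le> y \<Longrightarrow> y \<le> 2 * b - a \<Longrightarrow> mass (A k) b y \<le> \<tau> * (y - b)"
  shows "mass (A (k + i)) a b \<le> \<theta> ^ i * (b - a)"
proof (induction i)
  case 0
  then show ?case using mass_le_length[of "A k" a b] \<open>a \<le> b\<close> by simp
next
  case (Suc i)
  have "mass (A (Suc (k + i))) a b \<le> \<theta> * mass (A (k + i)) a b"
  proof (rule rising_sun_step)
    show "mass (A (k + i)) b y \<le> \<tau> * (y - b)" if "b \<le> y" "y \<le> 2 * b - a" for y
      using mass_level_antimono[of k "k + i" b y] sparse[OF that] by simp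
  qed (use open_level closure_level level_step thresholds \<open>a \<le> b\<close> in auto)
  also have "\<dots> \<le> \<theta> * (\<theta> ^ i * (b - a))"
    using Suc.IH ratio by (intro mult_left_mono) auto
  finally show ?case by simp
qed

text \<open>
  The level step makes the density of \<open>A 1\<close> on \<open>(u - r, u)\<close> at most \<open>\<sigma> < \<tau>\<close>. A right-sparse point of
  this interval can then lie no further than the fraction \<open>\<sigma> / \<tau>\<close> of the way from the left, which leaves
  room of length \<open>(1 - \<sigma> / \<tau>) * r\<close> on its right.
\<close>

lemma decay_start:
  assumes "0 < r" "mass (A 0) u (u + r) \<le> \<tau> * r"
  obtains z where "u - r \<le> z" "z \<le> u - (1 - \<theta>) * r"
    "\<And>i. mass (A (1 + i)) (z - (1 - \<theta>) * r) z \<le> \<theta> ^ i * ((1 - \<theta>) * r)"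
proof -
  have 1: "mass (A 1) (u - r) u \<le> \<sigma> * r"
    using level_step[of r 0 u] assms by simp
  obtain z where z: "u - r \<le> z" "z \<le> u" "\<tau> * (z - (u - r)) \<le> mass (A 1) (u - r) z"
    and zs: "\<And>y. z \<le> y \<Longrightarrow> y \<le> u \<Longrightarrow> mass (A 1) z y \<le> \<tau> * (y - z)"
    using exists_right_sparse_point[of "A 1" "u - r" u \<tau>] assms by auto
  have "mass (A 1) (u - r) z \<le> mass (A 1) (u - r) u"
    by (rule mass_mono) (use z in auto)
  with z 1 have "\<tau> * (z - (u - r)) \<le> \<sigma> * r" by linarith
  then have "z - (u - r) \<le> \<theta> * r"
    using thresholds by (simp add: field_simps)
  then have zu: "z \<le> u - (1 - \<theta>) * r" by (simp add: algebra_simps)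
  have "mass (A (1 + i)) (z - (1 - \<theta>) * r) z \<le> \<theta> ^ i * (z - (z - (1 - \<theta>) * r))" for i
  proof (rule decay_left_of_sparse_point)
    show "z - (1 - \<theta>) * r \<le> z" using ratio \<open>0 < r\<close> by simp
    show "mass (A 1) z y \<le> \<tau> * (y - z)" if "z \<le> y" "y \<le> 2 * z - (z - (1 - \<theta>) * r)" for y
      using zs[of y] that zu by simp
  qed
  then show thesis using that[of z] z zu by simp
qed

text \<open>
  After \<open>k0\<close> further levels the set is so thin on \<open>(z - L, z)\<close> that a right-sparse point \<open>x\<close> exists in
  the leftmost quarter of this interval. Decay to the left of \<open>x\<close> on a length of \<open>3 / 4 * L\<close> reaches
  beyond \<open>z - 3 / 2 * L\<close>. The contributions \<open>3 / 4 * L\<close> from the left of \<open>x\<close> and \<open>L / 4\<close> from its right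
  add up to \<open>L\<close>, so no constant is lost and the step can be repeated.
\<close>

lemma decay_extend:
  assumes k0: "\<theta> ^ k0 \<le> \<tau> / 4"
    and L: "0 < L" "L \<le> L'" "L' \<le> 3 / 2 * L"
    and Q: "\<And>i. mass (A (k + i)) (z - L) z \<le> \<theta> ^ i * L"
  shows "mass (A (k + k0 + i)) (z - L') z \<le> \<theta> ^ i * L'"
proof -
  obtain x where x: "z - L \<le> x" "x \<le> z" "\<tau> * (x - (z - L)) \<le> mass (A (k + k0)) (z - L) x"
    and xs: "\<And>y. x \<le> y \<Longrightarrow> y \<le> z \<Longrightarrow> mass (A (k + k0)) x y \<le> \<tau> * (y - x)"
    using exists_right_sparse_point[of "A (k + k0)" "z - L" z \<tau>] L by auto
  have "mass (A (k + k0)) (z - L) x \<le> mass (A (k + k0)) (z - L) z"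
    by (rule mass_mono) (use x in auto)
  also have "\<dots> \<le> \<theta> ^ k0 * L" by (rule Q)
  also have "\<dots> \<le> \<tau> / 4 * L" using k0 L by (intro mult_right_mono) auto
  finally have "\<tau> * (x - (z - L)) \<le> \<tau> * (L / 4)" using x by linarith
  then have xL: "x \<le> z - 3 / 4 * L" using thresholds by simp
  have left: "mass (A (k + k0 + i)) (x - 3 / 4 * L) x \<le> \<theta> ^ i * (x - (x - 3 / 4 * L))"
  proof (rule decay_left_of_sparse_point)
    show "mass (A (k + k0)) x y \<le> \<tau> * (y - x)" if "x \<le> y" "y \<le> 2 * x - (x - 3 / 4 * L)" for y
      using xs[of y] that xL by simp
  qed (use L in simp)
  have right: "mass (A (k + k0 + i)) x z \<le> \<theta> ^ i * (L / 4)"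
  proof -
    have "mass (A (k + k0 + i)) x z \<le> mass (A (k + (k0 + i))) (z - L) z"
      by (rule mass_mono) (use x in \<open>auto simp: add.assoc\<close>)
    also have "\<dots> \<le> \<theta> ^ (k0 + i) * L" by (rule Q)
    also have "\<dots> = \<theta> ^ i * (\<theta> ^ k0 * L)" by (simp add: power_add)
    also have "\<dots> \<le> \<theta> ^ i * (L / 4)"
    proof -
      have "\<theta> ^ k0 * L \<le> 1 / 4 * L"
        using k0 thresholds L by (intro mult_right_mono) auto
      then show ?thesis using ratio by (intro mult_left_mono) auto
    qed
    finally show ?thesis .
  qed
  have "mass (A (k + k0 + i)) (z - L') z \<le> mass (A (k + k0 + i)) (x - 3 / 4 * L) z"
    by (rule mass_mono) (use xL L in auto)
  also have "\<dots> = mass (A (k + k0 + i)) (x - 3 / 4 * L) x + mass (A (k + k0 + i)) x z"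
    by (rule mass_split) (use x L in auto)
  also have "\<dots> \<le> \<theta> ^ i * (3 / 4 * L) + \<theta> ^ i * (L / 4)"
    by (rule add_mono) (use left right in simp_all)
  also have "\<dots> = \<theta> ^ i * L" by (simp add: algebra_simps)
  also have "\<dots> \<le> \<theta> ^ i * L'" using L ratio by (intro mult_left_mono) auto
  finally show ?thesis .
qed

lemma decay_extend_iterated:
  assumes k0: "\<theta> ^ k0 \<le> \<tau> / 4" and "0 < L"
    and Q: "\<And>i. mass (A (k + i)) (z - L) z \<le> \<theta> ^ i * L"
  shows "L \<le> L' \<Longrightarrow> L' \<le> (3 / 2) ^ n * L \<Longrightarrow> mass (A (k + n * k0 + i)) (z - L') z \<le> \<theta> ^ i * L'"
proof (induction n arbitrary: L' i)
  case 0
  then show ?case using Q[of i] by (simp add: order_antisym)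
next
  case (Suc n)
  \<comment> \<open>The target length is reached from the length \<open>M\<close> in one more step.\<close>
  define M where "M = max L (2 / 3 * L')"
  have M: "L \<le> M" "M \<le> (3 / 2) ^ n * L" "M \<le> L'" "L' \<le> 3 / 2 * M"
    using Suc.prems \<open>0 < L\<close> by (auto simp: M_def max_def)
  have "mass (A (k + n * k0 + k0 + i)) (z - L') z \<le> \<theta> ^ i * L'"
    by (rule decay_extend[OF k0 _ M(3,4)]) (use Suc.IH M \<open>0 < L\<close> in auto)
  then show ?case by (simp add: algebra_simps)
qed

text \<open>
  The start supplies decay on an interval of length \<open>(1 - \<sigma> / \<tau>) * r\<close>. Enlarging it \<open>n0\<close> times covers
  the length \<open>r\<close>, and two enlargements cover each further doubling, as \<open>(3 / 2)\<^sup>2 \<ge> 2\<close>.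
\<close>

lemma decay_left:
  assumes k0: "\<theta> ^ k0 \<le> \<tau> / 4" and n0: "1 \<le> (3 / 2) ^ n0 * (1 - \<theta>)"
    and "0 < r" "mass (A 0) u (u + r) \<le> \<tau> * r"
  shows "mass (A ((1 + (n0 + 2) * k0) * (j + 1) + i)) (u - 2 ^ j * r) (u - r) \<le> \<theta> ^ i * (2 ^ j * r)"
proof -
  obtain z where z: "u - r \<le> z" "z \<le> u - (1 - \<theta>) * r"
    and Q: "\<And>i. mass (A (1 + i)) (z - (1 - \<theta>) * r) z \<le> \<theta> ^ i * ((1 - \<theta>) * r)"
    using decay_start[OF assms(3,4)] by blast
  have \<eta>: "0 < (1 - \<theta>) * r" using ratio \<open>0 < r\<close> by simp
  have two: "(2::real) ^ j \<le> (3 / 2) ^ (2 * j)"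
  proof -
    have "(2::real) ^ j \<le> (9 / 4) ^ j" by (rule power_mono) auto
    then show ?thesis by (simp add: power_mult power2_eq_square)
  qed
  have "2 ^ j * r \<le> (3 / 2) ^ (2 * j) * (1 * r)"
    using two \<open>0 < r\<close> by simp
  also have "\<dots> \<le> (3 / 2) ^ (2 * j) * ((3 / 2) ^ n0 * (1 - \<theta>) * r)"
    by (intro mult_left_mono mult_right_mono n0) (use \<open>0 < r\<close> in auto)
  finally have up: "2 ^ j * r \<le> (3 / 2) ^ (n0 + 2 * j) * ((1 - \<theta>) * r)"
    by (simp add: power_add algebra_simps)
  have "(1 - \<theta>) * r \<le> 1 * r"
    using ratio \<open>0 < r\<close> by (intro mult_right_mono) auto
  also have "\<dots> \<le> 2 ^ j * r" using \<open>0 < r\<close> by simp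
  finally have low: "(1 - \<theta>) * r \<le> 2 ^ j * r" .
  have lev: "1 + (n0 + 2 * j) * k0 + i \<le> (1 + (n0 + 2) * k0) * (j + 1) + i"
    by (simp add: algebra_simps)
  have "mass (A ((1 + (n0 + 2) * k0) * (j + 1) + i)) (u - 2 ^ j * r) (u - r)
      \<le> mass (A (1 + (n0 + 2 * j) * k0 + i)) (z - 2 ^ j * r) z"
    by (rule mass_mono)
      (use level_antimono[OF lev] z \<eta> in auto)
  also have "\<dots> \<le> \<theta> ^ i * (2 ^ j * r)"
    by (rule decay_extend_iterated[OF k0 \<eta> Q low up])
  finally show ?thesis .
qed

end

text \<open>
  After a number \<open>m * (j + 1)\<close> of levels that depends on the cascade only through \<open>\<sigma>\<close> and \<open>\<tau>\<close>, there is
  geometric decay on an interval \<open>2 ^ j\<close> times as long as the initial one. It is essential for summing over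
  scales that this cost is linear in \<open>j\<close> and that the rate stays the same for all \<open>j\<close>. The part next to
  the initial interval, of length \<open>r\<close>, is left out: the starting point of the decay lies somewhere in it.
\<close>

definition decay_shift :: "real \<Rightarrow> real \<Rightarrow> nat \<Rightarrow> bool" where
  "decay_shift \<sigma> \<tau> m \<longleftrightarrow>
     (\<forall>A u r i j. porous_cascade A \<sigma> \<tau> \<longrightarrow> 0 < r \<longrightarrow> mass (A 0) u (u + r) \<le> \<tau> * r \<longrightarrow>
        mass (A (m * (j + 1) + i)) (u - 2 ^ j * r) (u - r) \<le> (\<sigma> / \<tau>) ^ i * (2 ^ j * r))"

lemma exists_decay_shift:
  assumes "0 < \<sigma>" "\<sigma> < \<tau>" "\<tau> < (1::real)"
  obtains m where "decay_shift \<sigma> \<tau> m"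
proof -
  have \<theta>: "0 < \<sigma> / \<tau>" "\<sigma> / \<tau> < 1" using assms by auto
  obtain k0 where k0: "(\<sigma> / \<tau>) ^ k0 < \<tau> / 4"
    using real_arch_pow_inv[of "\<tau> / 4" "\<sigma> / \<tau>"] \<theta> assms by auto
  obtain n0 where "1 / (1 - \<sigma> / \<tau>) < (3 / 2) ^ n0"
    using real_arch_pow[of "3 / 2"] by auto
  then have n0: "1 \<le> (3 / 2) ^ n0 * (1 - \<sigma> / \<tau>)"
    using \<theta> by (simp add: pos_divide_less_eq)
  show thesis
    by (rule that[of "1 + (n0 + 2) * k0"], unfold decay_shift_def)
      (use porous_cascade.decay_left[OF _ less_imp_le[OF k0] n0] in blast)
qed

section \<open>Pores and the distance function\<close>

lemma infdist_ge_iff: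
  assumes "E \<noteq> {}"
  shows "r \<le> infdist x E \<longleftrightarrow> (\<forall>y\<in>E. r \<le> dist x y)"
  using assms by (auto simp: infdist_notempty intro: cINF_greatest order_trans[OF _ cINF_lower])

lemma closed_far [simp]: "closed {x. r \<le> infdist x E}"
  by (intro closed_Collect_le continuous_intros)

lemma closed_le_infdist [simp]: "closed {x. infdist x E \<le> r}"
  by (intro closed_Collect_le continuous_intros)

lemma open_infdist_less [simp]: "open {x. infdist x E < r}"
  by (intro open_Collect_less continuous_intros)

lemma open_infdist_greater [simp]: "open {x. r < infdist x E}"
  by (intro open_Collect_less continuous_intros)

lemma open_sets_lebesgue: "open A \<Longrightarrow> A \<in> sets lebesgue"
  by (simp add: borel_open)

lemma closed_sets_lebesgue: "closed A \<Longrightarrow> A \<in> sets lebesgue"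
  by (simp add: borel_closed)

lemmas infdist_level_sets [simp] =
  closed_far[THEN closed_sets_lebesgue] closed_le_infdist[THEN closed_sets_lebesgue]
  open_infdist_less[THEN open_sets_lebesgue] open_infdist_greater[THEN open_sets_lebesgue]

lemma mass_far_eq:
  assumes "a \<le> b"
  shows "mass {x. r \<le> infdist x E} a b = (b - a) - mass {x. infdist x E < r} a b"
proof -
  have "{x. r \<le> infdist x E} = - {x. infdist x E < r}" by auto
  then show ?thesis using mass_compl[of "{x. infdist x E < r}" a b] assms by simp
qed

text \<open>
  In a pore of length at least \<open>l\<close>, removing the margins of width \<open>\<eta> * l\<close> at both ends costs at most a
  fraction \<open>2 * \<eta>\<close> of its length, and what remains has distance at least \<open>\<eta> * l\<close> from \<open>E\<close>.
\<close>

lemma mass_far_if_has_pores: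
  assumes "E \<noteq> {}" and pores: "has_pores E {a<..<b} l m" and "0 < l" "0 \<le> \<eta>" "\<eta> \<le> 1 / 2"
  shows "(1 - 2 * \<eta>) * m \<le> mass {x. \<eta> * l \<le> infdist x E} a b"
proof -
  obtain k :: nat and u v where
    uv: "\<And>i. i < k \<Longrightarrow> u i < v i \<and> {u i<..<v i} \<subseteq> {a<..<b} - E \<and> l \<le> v i - u i"
    and disj: "disjoint_family_on (\<lambda>i. {u i<..<v i}) {..<k}"
    and m: "m \<le> (\<Sum>i<k. v i - u i)"
    using pores unfolding has_pores_def by blast
  define G where "G i = {u i + \<eta> * l<..<v i - \<eta> * l}" for i
  have "(1 - 2 * \<eta>) * m \<le> (1 - 2 * \<eta>) * (\<Sum>i<k. v i - u i)"
    using m assms by (intro mult_left_mono) auto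
  also have "\<dots> \<le> (\<Sum>i<k. (v i - u i) - 2 * \<eta> * l)"
    unfolding sum_distrib_left
  proof (rule sum_mono)
    fix i assume "i \<in> {..<k}"
    then have "2 * \<eta> * l \<le> 2 * \<eta> * (v i - u i)"
      using uv assms by (intro mult_left_mono) auto
    then show "(1 - 2 * \<eta>) * (v i - u i) \<le> v i - u i - 2 * \<eta> * l"
      by (simp add: algebra_simps)
  qed
  also have "\<dots> \<le> (\<Sum>i<k. measure lebesgue (G i))"
  proof (rule sum_mono)
    fix i assume "i \<in> {..<k}"
    then have "2 * \<eta> * l \<le> 1 * l" "l \<le> v i - u i"
      using uv assms by (auto intro!: mult_right_mono simp del: mult_1)
    then have "u i + \<eta> * l \<le> v i - \<eta> * l" by linarith
    then show "v i - u i - 2 * \<eta> * l \<le> measure lebesgue (G i)" by (simp add: G_def)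
  qed
  also have "\<dots> = measure lebesgue (\<Union>i<k. G i)"
  proof (rule measure_finite_Union[symmetric])
    have "G i \<subseteq> {u i<..<v i}" for i
    proof -
      have "0 \<le> \<eta> * l" using assms by simp
      then show ?thesis by (auto simp: G_def)
    qed
    then show "disjoint_family_on G {..<k}"
      using disj unfolding disjoint_family_on_def by blast
    show "emeasure lebesgue (G i) \<noteq> \<infinity>" for i
      using fmeasurableD2[of "G i" lebesgue] by (simp add: G_def)
  qed (auto simp: G_def)
  also have "\<dots> \<le> mass {x. \<eta> * l \<le> infdist x E} a b"
    unfolding mass_def
  proof (rule measure_mono_fmeasurable)
    have *: "x \<in> {x. \<eta> * l \<le> infdist x E} \<inter> {a<..<b}" if "i < k" "x \<in> G i" for i x
    proof -
      have "0 \<le> \<eta> * l" using assms by simp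
      then have x: "x \<in> {u i<..<v i}" using that by (auto simp: G_def)
      have "\<eta> * l \<le> dist x y" if "y \<in> E" for y
      proof -
        have "y \<notin> {u i<..<v i}" using uv[OF \<open>i < k\<close>] that by blast
        then show ?thesis using \<open>x \<in> G i\<close> x by (auto simp: G_def dist_real_def)
      qed
      then show ?thesis using uv[OF \<open>i < k\<close>] x assms(1) by (auto simp: infdist_ge_iff)
    qed
    then show "(\<Union>i<k. G i) \<subseteq> {x. \<eta> * l \<le> infdist x E} \<inter> {a<..<b}" by blast
    show "(\<Union>i<k. G i) \<in> sets lebesgue" unfolding G_def by (intro sets.finite_UN) auto
  qed auto
  finally show ?thesis .
qed

lemma open_connected_bounded_real:
  fixes c :: "real set"
  assumes "open c" "connected c" "bounded c" "c \<noteq> {}"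
  shows "c = {Inf c<..<Sup c}" "Inf c < Sup c"
proof -
  have bd: "bdd_above c" "bdd_below c"
    using assms by (auto simp: bounded_imp_bdd_above bounded_imp_bdd_below)
  have *: "Inf c < x \<and> x < Sup c" if "x \<in> c" for x
  proof -
    obtain e where e: "0 < e" "\<And>y. dist y x < e \<Longrightarrow> y \<in> c"
      using assms(1) \<open>x \<in> c\<close> by (auto simp: open_dist)
    then have "x - e / 2 \<in> c" "x + e / 2 \<in> c" by (auto simp: dist_real_def)
    then show ?thesis using cInf_lower[OF _ bd(2)] cSup_upper[OF _ bd(1)] e(1)
      by (meson field_sum_of_halves less_add_same_cancel1 half_gt_zero less_le_trans le_less_trans diff_less_eq)
  qed
  show "c = {Inf c<..<Sup c}"
  proof (intro equalityI subsetI)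
    fix x assume x: "x \<in> {Inf c<..<Sup c}"
    obtain y where y: "y \<in> c" "y < x" using x cInf_less_iff[OF assms(4) bd(2)] by auto
    obtain z where z: "z \<in> c" "x < z" using x less_cSup_iff[OF assms(4) bd(1)] by auto
    show "x \<in> c" using connectedD_interval[OF assms(2) y(1) z(1)] y z by auto
  qed (use * in auto)
  show "Inf c < Sup c" using assms(4) * by fastforce
qed

text \<open>
  Around each point at distance at least \<open>r\<close> from \<open>E\<close>, the \<open>r\<close>-neighbourhood within \<open>(a, b)\<close> avoids \<open>E\<close> and
  has length at least \<open>r\<close>, since \<open>r \<le> b - a\<close>. The pores are the components of the union of these
  neighbourhoods; their number is at most \<open>(b - a) / r\<close>.
\<close>

lemma has_pores_if_mass_far:
  assumes "E \<noteq> {}" and r: "0 < r" "r \<le> b - a" and m: "0 < m" "m \<le> mass {x. r \<le> infdist x E} a b"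
  shows "has_pores E {a<..<b} r m"
proof -
  define G where "G = {x. r \<le> infdist x E} \<inter> {a<..<b}"
  define U where "U = (\<Union>x\<in>G. {max a (x - r)<..<min b (x + r)})"
  have "open U" unfolding U_def by (intro open_UN) auto
  have "U \<subseteq> {a<..<b}" unfolding U_def by auto
  then have "bounded U" by (rule bounded_subset[rotated]) simp
  have UE: "U \<inter> E = {}"
  proof -
    have False if "x \<in> G" "y \<in> E" "x - r < y" "y < x + r" for x y
    proof -
      have "r \<le> dist x y" using that assms(1) by (auto simp: G_def infdist_ge_iff)
      then show False using that by (auto simp: dist_real_def)
    qed
    then show ?thesis by (fastforce simp: U_def)
  qed
  have GU: "G \<subseteq> U" using r by (force simp: U_def G_def)
  define C where "C = components U"
  have C: "open c" "connected c" "bounded c" "c \<noteq> {}" "c \<subseteq> U" if "c \<in> C" for c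
    using that \<open>open U\<close> bounded_subset[OF \<open>bounded U\<close>] unfolding C_def
    by (blast intro: open_components dest: in_components_connected in_components_nonempty
        in_components_subset)+
  have len: "c = {Inf c<..<Sup c}" "Inf c < Sup c" "r \<le> Sup c - Inf c" if c: "c \<in> C" for c
  proof -
    show eq: "c = {Inf c<..<Sup c}" and lt: "Inf c < Sup c"
      using open_connected_bounded_real[OF C(1-4)[OF c]] by auto
    obtain y where y: "y \<in> c" "y \<in> U" using C[OF c] by auto
    then obtain x where x: "x \<in> G" "y \<in> {max a (x - r)<..<min b (x + r)}" by (auto simp: U_def)
    have "{max a (x - r)<..<min b (x + r)} \<subseteq> c"
      by (rule components_maximal[OF c[unfolded C_def]])
        (use x y in \<open>auto simp: U_def\<close>)
    then have sub: "{max a (x - r)<..<min b (x + r)} \<subseteq> {Inf c<..<Sup c}" using eq by simp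
    have "Inf c \<le> max a (x - r)" "min b (x + r) \<le> Sup c"
      using sub x greaterThanLessThan_subseteq_greaterThanLessThan[of "max a (x - r)" "min b (x + r)" "Inf c" "Sup c"]
      by auto
    moreover have "r \<le> min b (x + r) - max a (x - r)"
      using x r by (auto simp: G_def min_def max_def)
    ultimately show "r \<le> Sup c - Inf c" by linarith
  qed
  have meas: "measure lebesgue c = Sup c - Inf c" "c \<in> lmeasurable" if "c \<in> C" for c
  proof -
    have "measure lebesgue {Inf c<..<Sup c} = Sup c - Inf c" "{Inf c<..<Sup c} \<in> lmeasurable"
      using len(2)[OF that] by auto
    then show "measure lebesgue c = Sup c - Inf c" "c \<in> lmeasurable"
      using len(1)[OF that] by auto
  qed
  have disjC: "disjoint C" unfolding C_def
    by (auto simp: pairwise_def disjnt_def dest: components_nonoverlap)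
  have sum_meas: "(\<Sum>c\<in>F. measure lebesgue c) = measure lebesgue (\<Union>F)"
    if "F \<subseteq> C" "finite F" for F
    using measure_Union'[of F lebesgue] that meas disjC
    by (auto simp: pairwise_subset subset_iff)
  have "U \<in> lmeasurable" using \<open>open U\<close> \<open>bounded U\<close> by (rule lmeasurable_open[rotated])
  have "card F \<le> nat \<lfloor>(b - a) / r\<rfloor>" if F: "F \<subseteq> C" "finite F" for F
  proof -
    have "r * card F = (\<Sum>c\<in>F. r)" by simp
    also have "\<dots> \<le> (\<Sum>c\<in>F. measure lebesgue c)"
      by (rule sum_mono) (use F meas len in auto)
    also have "\<dots> = measure lebesgue (\<Union>F)" by (rule sum_meas[OF F])
    also have "\<dots> \<le> measure lebesgue {a<..<b}"
    proof (rule measure_mono_fmeasurable)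
      show "\<Union>F \<subseteq> {a<..<b}" using F C(5) \<open>U \<subseteq> {a<..<b}\<close> by blast
      show "\<Union>F \<in> sets lebesgue"
        using F meas(2) by (intro sets.finite_Union) (auto intro: fmeasurableD)
    qed auto
    also have "\<dots> = b - a" using r by simp
    finally have "real (card F) \<le> (b - a) / r" using r by (simp add: field_simps)
    then show ?thesis using r by (simp add: le_nat_floor)
  qed
  then have "finite C" using finite_if_finite_subsets_card_bdd by blast
  obtain f where f: "bij_betw f {..<card C} C"
    using ex_bij_betw_nat_finite[OF \<open>finite C\<close>] by (auto simp: lessThan_atLeast0)
  have fC: "f i \<in> C" if "i < card C" for i using f that by (auto simp: bij_betw_def)
  have "m \<le> measure lebesgue G" using m by (simp add: mass_def G_def)
  also have "\<dots> \<le> measure lebesgue U"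
    by (rule measure_mono_fmeasurable[OF GU])
      (use \<open>U \<in> lmeasurable\<close> in \<open>auto simp: G_def\<close>)
  also have "U = \<Union>C" unfolding C_def by simp
  also have "measure lebesgue (\<Union>C) = (\<Sum>c\<in>C. measure lebesgue c)"
    using sum_meas[OF subset_refl \<open>finite C\<close>] by simp
  also have "\<dots> = (\<Sum>c\<in>C. Sup c - Inf c)" using meas by simp
  also have "\<dots> = (\<Sum>i<card C. Sup (f i) - Inf (f i))"
    by (rule sum.reindex_bij_betw[OF f, symmetric])
  finally have total: "m \<le> (\<Sum>i<card C. Sup (f i) - Inf (f i))" .
  have iv: "{Inf (f i)<..<Sup (f i)} = f i" if "i < card C" for i
    using len(1)[OF fC[OF that]] by simp
  show ?thesis unfolding has_pores_def
  proof (intro exI conjI allI impI)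
    show "1 \<le> card C" using total m by (cases "card C") auto
    show "m \<le> (\<Sum>i<card C. Sup (f i) - Inf (f i))" by (rule total)
    show "disjoint_family_on (\<lambda>i. {Inf (f i)<..<Sup (f i)}) {..<card C}"
    proof (unfold disjoint_family_on_def, intro ballI impI)
      fix i j assume ij: "i \<in> {..<card C}" "j \<in> {..<card C}" "i \<noteq> j"
      then have "f i \<noteq> f j" using f by (auto simp: bij_betw_def inj_on_def)
      then have "f i \<inter> f j = {}"
        using disjC fC ij by (auto simp: pairwise_def disjnt_def)
      then show "{Inf (f i)<..<Sup (f i)} \<inter> {Inf (f j)<..<Sup (f j)} = {}"
        using iv ij by simp
    qed
    fix i assume i: "i < card C"
    show "Inf (f i) < Sup (f i)" "r \<le> Sup (f i) - Inf (f i)" using len fC[OF i] by auto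
    show "{Inf (f i)<..<Sup (f i)} \<subseteq> {a<..<b} - E"
      using iv[OF i] C(5)[OF fC[OF i]] UE \<open>U \<subseteq> {a<..<b}\<close> by auto
  qed
qed

section \<open>Transfer of small distances from right to left\<close>

lemma length_le_if_has_pores:
  assumes "has_pores E {a<..<b} l m"
  shows "l \<le> b - a"
proof -
  obtain k :: nat and u v where "1 \<le> k"
    "\<And>i. i < k \<Longrightarrow> u i < v i \<and> {u i<..<v i} \<subseteq> {a<..<b} - E \<and> l \<le> v i - u i"
    using assms unfolding has_pores_def by blast
  then have uv: "u 0 < v 0" "{u 0<..<v 0} \<subseteq> {a<..<b}" "l \<le> v 0 - u 0" by fastforce+
  then have "a \<le> u 0" "v 0 \<le> b"
    using greaterThanLessThan_subseteq_greaterThanLessThan[of "u 0" "v 0" a b] by auto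
  then show ?thesis using uv by linarith
qed

lemma has_pores_antimono:
  assumes "has_pores E J l m" "l' \<le> l"
  shows "has_pores E J l' m"
proof -
  obtain k :: nat and u v where
    "1 \<le> k" "\<forall>i<k. u i < v i \<and> {u i<..<v i} \<subseteq> J - E \<and> l \<le> v i - u i"
    "disjoint_family_on (\<lambda>i. {u i<..<v i}) {..<k}" "m \<le> (\<Sum>i<k. v i - u i)"
    using assms unfolding has_pores_def by blast
  with assms(2) show ?thesis unfolding has_pores_def by (meson order_trans)
qed

text \<open>
  Porosity promises a pore length proportional to the one on the right, a bound that may a priori be
  zero; finitely many nonempty pores nevertheless have a positive minimal length.
\<close>

lemma has_pores_positive_length:
  assumes "has_pores E J l m"
  obtains l' where "0 < l'" "has_pores E J l' m"
proof -
  obtain k :: nat and u v where k: "1 \<le> k"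
    and uv: "\<forall>i<k. u i < v i \<and> {u i<..<v i} \<subseteq> J - E \<and> l \<le> v i - u i"
    and disj: "disjoint_family_on (\<lambda>i. {u i<..<v i}) {..<k}" "m \<le> (\<Sum>i<k. v i - u i)"
    using assms unfolding has_pores_def by blast
  define l' where "l' = Min ((\<lambda>i. v i - u i) ` {..<k})"
  have ne: "(\<lambda>i. v i - u i) ` {..<k} \<noteq> {}" using k by (auto simp: lessThan_empty_iff)
  have "l' \<in> (\<lambda>i. v i - u i) ` {..<k}" unfolding l'_def by (rule Min_in) (use ne in auto)
  then have "0 < l'" using uv by auto
  moreover have "l' \<le> v i - u i" if "i < k" for i
    unfolding l'_def by (rule Min_le) (use that in auto)
  then have "has_pores E J l' m"
    unfolding has_pores_def using k uv disj by blast
  ultimately show thesis by (rule that)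
qed

lemma pore_length_ge:
  assumes "0 < l" "has_pores E {a<..<b} l ((1 - t) * (b - a))"
  shows "l \<le> pore_length t E a b"
proof -
  define S where "S = {l. l > 0 \<and> has_pores E {a <..< b} l ((1 - t) * (b - a))}"
  have "l \<in> S" using assms by (simp add: S_def)
  moreover have "bdd_above S" unfolding S_def
    by (rule bdd_aboveI[of _ "b - a"]) (use length_le_if_has_pores in auto)
  ultimately have "l \<le> Sup S" by (rule cSup_upper)
  moreover have "pore_length t E a b = Sup S"
    using \<open>l \<in> S\<close> by (auto simp: pore_length_def S_def Let_def)
  ultimately show ?thesis by simp
qed

lemma pore_length_nonneg: "0 \<le> pore_length t E a b"
proof (cases "{l. l > 0 \<and> has_pores E {a <..< b} l ((1 - t) * (b - a))} = {}")
  case False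
  then obtain l where "l > 0" "has_pores E {a <..< b} l ((1 - t) * (b - a))" by blast
  then show ?thesis using pore_length_ge[of l E a b t] by linarith
qed (simp add: pore_length_def)

lemma less_pore_lengthD:
  assumes "l < pore_length t E a b" "0 \<le> l"
  obtains l' where "l < l'" "has_pores E {a<..<b} l' ((1 - t) * (b - a))"
proof -
  define S where "S = {l. l > 0 \<and> has_pores E {a <..< b} l ((1 - t) * (b - a))}"
  have "S \<noteq> {}" using assms by (auto simp: pore_length_def S_def Let_def split: if_splits)
  moreover have "bdd_above S" unfolding S_def
    by (rule bdd_aboveI[of _ "b - a"]) (use length_le_if_has_pores in auto)
  moreover have "l < Sup S"
    using assms \<open>S \<noteq> {}\<close> by (auto simp: pore_length_def S_def Let_def split: if_splits)
  ultimately obtain l' where "l' \<in> S" "l < l'" by (auto simp: less_cSup_iff)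
  then show thesis using that by (auto simp: S_def)
qed

lemma right_median_porousD:
  assumes "right_median_porous_const s t \<delta> E" "0 < r"
  shows "has_pores E {v - r<..<v} (\<delta> * pore_length t E v (v + r)) ((1 - s) * r)"
proof -
  have "((v - r) + (v + r)) / 2 = v" by simp
  then show ?thesis
    using assms(1)[unfolded right_median_porous_const_def, rule_format, of "v - r" "v + r"] assms(2)
    by simp
qed

text \<open>
  The margin fraction that the gap between \<open>s\<close> and \<open>\<sigma>\<close> allows one to remove from the pores.
\<close>

lemma exists_shrink_factor:
  fixes s \<sigma> :: real
  assumes "s < \<sigma>" "\<sigma> < 1"
  obtains \<eta> where "0 < \<eta>" "\<eta> \<le> 1 / 2" "(1 - 2 * \<eta>) * (1 - s) = 1 - \<sigma>"
proof
  define q where "q = (1 - \<sigma>) / (1 - s)"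
  have "0 < q" "q < 1" "q * (1 - s) = 1 - \<sigma>"
    using assms by (auto simp: q_def)
  then show "0 < (1 - q) / 2" "(1 - q) / 2 \<le> 1 / 2" "(1 - 2 * ((1 - q) / 2)) * (1 - s) = 1 - \<sigma>"
    by (auto simp: field_simps)
qed

lemma mass_infdist_small:
  assumes "E \<noteq> {}" and por: "right_median_porous s t E" and "s < \<sigma>" "\<sigma> < 1" "0 < r"
  obtains \<rho> where "0 < \<rho>" "mass {x. infdist x E < \<rho>} u (u + r) \<le> \<sigma> * r"
proof -
  obtain \<eta> where \<eta>: "0 < \<eta>" "\<eta> \<le> 1 / 2" "(1 - 2 * \<eta>) * (1 - s) = 1 - \<sigma>"
    using exists_shrink_factor assms by blast
  obtain \<delta> where \<delta>: "right_median_porous_const s t \<delta> E"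
    using por by (auto simp: right_median_porous_def)
  obtain l where l: "0 < l" "has_pores E {u<..<u + r} l ((1 - s) * r)"
    using has_pores_positive_length right_median_porousD[OF \<delta> \<open>0 < r\<close>, of "u + r"]
    by (metis add_diff_cancel_right')
  have "(1 - 2 * \<eta>) * ((1 - s) * r) \<le> mass {x. \<eta> * l \<le> infdist x E} u (u + r)"
    by (rule mass_far_if_has_pores[OF assms(1) l(2,1)]) (use \<eta> in auto)
  then have "(1 - \<sigma>) * r \<le> mass {x. \<eta> * l \<le> infdist x E} u (u + r)"
    using \<eta>(3) by (simp add: mult.assoc[symmetric])
  then have "mass {x. infdist x E < \<eta> * l} u (u + r) \<le> \<sigma> * r"
    using mass_far_eq[of u "u + r" "\<eta> * l" E] \<open>0 < r\<close> by (simp add: algebra_simps)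
  then show thesis using that[of "\<eta> * l"] \<eta> l by simp
qed

text \<open>
  If \<open>\<rho>\<close> is small compared to \<open>r\<close>, many points at distance at least \<open>\<rho>\<close> on the right produce pores of
  length \<open>\<rho> / 4\<close> there, and porosity provides comparable pores on the left. For \<open>\<rho> \<ge> 4 * r\<close>, where a pore
  of length comparable to \<open>\<rho>\<close> does not fit, a single point with \<open>d \<ge> \<rho>\<close> on the right already forces
  \<open>d \<ge> \<rho> / 2\<close> on both intervals, as \<open>d\<close> is 1-Lipschitz.
\<close>

lemma mass_infdist_transfer:
  assumes "E \<noteq> {}" and por: "right_median_porous s t E" and "0 < s" "s < \<sigma>" "\<sigma> < 1" "t < 1"
  obtains c where "0 < c" "c \<le> 1 / 2"
    "\<And>\<rho> v r. 0 < \<rho> \<Longrightarrow> 0 < r \<Longrightarrow> mass {x. infdist x E < \<rho>} v (v + r) \<le> t * r \<Longrightarrow>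
      mass {x. infdist x E < c * \<rho>} (v - r) v \<le> \<sigma> * r"
proof -
  obtain \<eta> where \<eta>: "0 < \<eta>" "\<eta> \<le> 1 / 2" "(1 - 2 * \<eta>) * (1 - s) = 1 - \<sigma>"
    using exists_shrink_factor assms by blast
  obtain \<delta> where \<delta>: "0 < \<delta>" "\<delta> < 1" "right_median_porous_const s t \<delta> E"
    using por by (auto simp: right_median_porous_def)
  define c where "c = \<eta> * \<delta> / 4"
  have "\<eta> * \<delta> \<le> 1 * 1" using \<eta> \<delta> by (intro mult_mono) auto
  then have c: "0 < c" "c \<le> 1 / 2" using \<eta> \<delta> by (auto simp: c_def mult.commute)
  have "mass {x. infdist x E < c * \<rho>} (v - r) v \<le> \<sigma> * r"
    if "0 < \<rho>" "0 < r" and near: "mass {x. infdist x E < \<rho>} v (v + r) \<le> t * r" for \<rho> v r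
  proof -
    have far: "(1 - t) * r \<le> mass {x. \<rho> \<le> infdist x E} v (v + r)"
      using near mass_far_eq[of v "v + r" \<rho> E] \<open>0 < r\<close> by (simp add: algebra_simps)
    have pos: "0 < (1 - t) * r" using \<open>0 < r\<close> \<open>t < 1\<close> by simp
    have main: "(1 - \<sigma>) * r \<le> mass {x. c * \<rho> \<le> infdist x E} (v - r) v"
    proof (cases "\<rho> < 4 * r")
      case True
      have "has_pores E {v<..<v + r} (\<rho> / 4) ((1 - t) * r)"
      proof (rule has_pores_if_mass_far[OF assms(1)])
        have "mass {x. \<rho> \<le> infdist x E} v (v + r) \<le> mass {x. \<rho> / 4 \<le> infdist x E} v (v + r)"
        proof (rule mass_mono)
          show "{x. \<rho> \<le> infdist x E} \<inter> {v<..<v + r} \<subseteq> {x. \<rho> / 4 \<le> infdist x E}"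
            using \<open>0 < \<rho>\<close> by auto
        qed (rule order_refl infdist_level_sets)+
        with far show "(1 - t) * r \<le> mass {x. \<rho> / 4 \<le> infdist x E} v (v + r)" by linarith
      qed (use \<open>0 < \<rho>\<close> True pos in auto)
      then have L: "\<rho> / 4 \<le> pore_length t E v (v + r)"
        using pore_length_ge[of "\<rho> / 4" E v "v + r" t] \<open>0 < \<rho>\<close> by simp
      have "has_pores E {v - r<..<v} (\<delta> * (\<rho> / 4)) ((1 - s) * r)"
        by (rule has_pores_antimono[OF right_median_porousD[OF \<delta>(3) \<open>0 < r\<close>]])
          (use L \<delta> in simp)
      then have "(1 - 2 * \<eta>) * ((1 - s) * r) \<le> mass {x. \<eta> * (\<delta> * (\<rho> / 4)) \<le> infdist x E} (v - r) v"
        by (rule mass_far_if_has_pores[OF assms(1)]) (use \<eta> \<delta> \<open>0 < \<rho>\<close> in auto)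
      also have "\<eta> * (\<delta> * (\<rho> / 4)) = c * \<rho>" by (simp add: c_def)
      also have "(1 - 2 * \<eta>) * ((1 - s) * r) = (1 - \<sigma>) * r"
        using \<eta>(3) by (simp only: mult.assoc[symmetric])
      finally show ?thesis .
    next
      case False
      obtain x where x: "v < x" "x < v + r" "\<rho> \<le> infdist x E"
      proof -
        have "{x. \<rho> \<le> infdist x E} \<inter> {v<..<v + r} \<noteq> {}"
          using far pos by (auto simp: mass_def)
        then show thesis using that by auto
      qed
      have "c * \<rho> \<le> infdist y E" if "v - r < y" "y < v" for y
      proof -
        have "c * \<rho> \<le> 1 / 2 * \<rho>" using c \<open>0 < \<rho>\<close> by (intro mult_right_mono) auto
        moreover have "infdist x E \<le> infdist y E + dist x y" by (rule infdist_triangle)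
        moreover have "dist x y < 2 * r" using x that by (simp add: dist_real_def)
        ultimately show ?thesis using x False by linarith
      qed
      then have "mass {x. c * \<rho> \<le> infdist x E} (v - r) v = v - (v - r)"
        by (intro mass_full) (use \<open>0 < r\<close> in auto)
      moreover have "(1 - \<sigma>) * r \<le> 1 * r"
        using \<open>0 < r\<close> \<open>0 < s\<close> \<open>s < \<sigma>\<close> by (intro mult_right_mono) auto
      ultimately show ?thesis by simp
    qed
    then show ?thesis
      using mass_far_eq[of "v - r" v "c * \<rho>" E] \<open>0 < r\<close> by (simp add: algebra_simps)
  qed
  with c show thesis using that by blast
qed

lemma mass_reflect:
  assumes "A \<in> sets borel"
  shows "mass {x. - x \<in> A} u v = mass A (- v) (- u)"
proof -
  have "measure lborel (uminus -` (A \<inter> {- v<..<- u}) \<inter> space borel) =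
      measure (distr lborel borel uminus) (A \<inter> {- v<..<- u})"
    by (subst measure_distr) (use assms in auto)
  also have "\<dots> = measure lborel (A \<inter> {- v<..<- u})" by (simp add: lborel_distr_uminus)
  also have "uminus -` (A \<inter> {- v<..<- u}) \<inter> space borel = {x. - x \<in> A} \<inter> {u<..<v}" by auto
  finally have "measure lborel ({x. - x \<in> A} \<inter> {u<..<v}) = measure lborel (A \<inter> {- v<..<- u})" .
  moreover have "{x. - x \<in> A} \<in> sets borel"
    using measurable_sets[OF borel_measurable_uminus[OF measurable_ident] assms]
    by (simp add: vimage_def)
  ultimately show ?thesis unfolding mass_def using assms by simp
qed

lemma infdist_uminus_set: "infdist (- x) E = infdist x (uminus ` E)" for x :: real
proof -
  have "dist (- x) a = dist x (- a)" for a by (simp add: dist_real_def)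
  then show ?thesis by (auto simp: infdist_def image_image)
qed

text \<open>
  What right median porosity is used for: the transfer property, and the existence of some level at
  which a given interval is sparse, from which the decay can start.
\<close>

locale distance_transfer =
  fixes E :: "real set" and c \<sigma> \<tau> :: real
  assumes small: "\<And>u r. 0 < r \<Longrightarrow> \<exists>\<rho>>0. mass {x. infdist x E < \<rho>} u (u + r) \<le> \<tau> * r"
    and c: "0 < c" "c \<le> 1 / 2" and thresholds: "0 < \<sigma>" "\<sigma> < \<tau>" "\<tau> < 1"
    and transfer: "\<And>\<rho> v r. 0 < \<rho> \<Longrightarrow> 0 < r \<Longrightarrow>
      mass {x. infdist x E < \<rho>} v (v + r) \<le> \<tau> * r \<Longrightarrow>
      mass {x. infdist x E < c * \<rho>} (v - r) v \<le> \<sigma> * r"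
begin

text \<open>
  The ratio \<open>c / 2\<close> instead of \<open>c\<close> makes the levels agree with those of \<open>porous_cascade_far\<close>, where the
  factor 2 is needed.
\<close>

lemma porous_cascade_near:
  assumes "0 < \<rho>"
  shows "porous_cascade (\<lambda>n. {x. infdist x E < \<rho> * (c / 2) ^ n}) \<sigma> \<tau>"
proof
  fix n
  have pos: "0 < \<rho> * (c / 2) ^ n" using assms c by simp
  have less: "\<rho> * (c / 2) ^ Suc n < \<rho> * (c / 2) ^ n"
    using mult_strict_left_mono[OF _ pos, of "c / 2" 1] c by (simp add: mult_ac)
  have "closure {x. infdist x E < \<rho> * (c / 2) ^ Suc n} \<subseteq> {x. infdist x E \<le> \<rho> * (c / 2) ^ Suc n}"
    by (rule closure_minimal[OF _ closed_le_infdist]) auto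
  then show "closure {x. infdist x E < \<rho> * (c / 2) ^ Suc n} \<subseteq> {x. infdist x E < \<rho> * (c / 2) ^ n}"
    using less by fastforce
  fix r v
  assume "0 < r" "mass {x. infdist x E < \<rho> * (c / 2) ^ n} v (v + r) \<le> \<tau> * r"
  then have "mass {x. infdist x E < c * (\<rho> * (c / 2) ^ n)} (v - r) v \<le> \<sigma> * r"
    using transfer pos by blast
  moreover have "mass {x. infdist x E < \<rho> * (c / 2) ^ Suc n} (v - r) v
      \<le> mass {x. infdist x E < c * (\<rho> * (c / 2) ^ n)} (v - r) v"
  proof (rule mass_mono)
    have "\<rho> * (c / 2) ^ Suc n \<le> c * (\<rho> * (c / 2) ^ n)"
      using mult_right_mono[of "c / 2" c "\<rho> * (c / 2) ^ n"] pos c by (simp add: mult_ac)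
    then show "{x. infdist x E < \<rho> * (c / 2) ^ Suc n} \<inter> {v - r<..<v}
        \<subseteq> {x. infdist x E < c * (\<rho> * (c / 2) ^ n)}" by (blast intro: less_le_trans)
  qed (rule order_refl infdist_level_sets)+
  ultimately show "mass {x. infdist x E < \<rho> * (c / 2) ^ Suc n} (v - r) v \<le> \<sigma> * r" by linarith
qed (use thresholds in auto)

text \<open>
  The contrapositive of the transfer property: if \<open>d \<ge> c * \<mu>\<close> on a fraction less than \<open>1 - \<sigma>\<close> of the left
  interval, then \<open>d \<ge> \<mu>\<close> on a fraction less than \<open>1 - \<tau>\<close> of the right one. So large distances
  pass from left to right with the thresholds \<open>1 - \<tau> < 1 - \<sigma>\<close>; the reflection \<open>x \<mapsto> - x\<close> restores the
  direction of \<open>porous_cascade\<close>. The average of \<open>\<sigma>\<close> and \<open>\<tau>\<close> replaces \<open>\<sigma>\<close> because the inequality on the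
  left has to be strict, and the ratio \<open>2 / c\<close> replaces \<open>1 / c\<close> to pass from \<open>d > \<rho>\<close> to \<open>d \<ge> 2 * \<rho>\<close>.
\<close>

lemma porous_cascade_far:
  assumes "0 < \<rho>"
  shows "porous_cascade (\<lambda>n. {x. \<rho> * (2 / c) ^ n < infdist (- x) E}) (1 - \<tau>) (1 - (\<sigma> + \<tau>) / 2)"
proof
  fix n
  have pos: "0 < \<rho> * (2 / c) ^ n" using assms c by simp
  have less: "2 * (\<rho> * (2 / c) ^ n) \<le> c * (\<rho> * (2 / c) ^ Suc n)"
    using pos c by (simp add: field_simps)
  have less': "\<rho> * (2 / c) ^ n < \<rho> * (2 / c) ^ Suc n"
    using mult_strict_left_mono[OF _ pos, of 1 "2 / c"] c by (simp add: mult_ac)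
  show "open {x. \<rho> * (2 / c) ^ n < infdist (- x) E}"
    by (simp add: infdist_uminus_set)
  have "closure {x. \<rho> * (2 / c) ^ Suc n < infdist (- x) E} \<subseteq> {x. \<rho> * (2 / c) ^ Suc n \<le> infdist (- x) E}"
    by (rule closure_minimal) (auto simp: infdist_uminus_set)
  then show "closure {x. \<rho> * (2 / c) ^ Suc n < infdist (- x) E} \<subseteq> {x. \<rho> * (2 / c) ^ n < infdist (- x) E}"
    using less' by fastforce
  fix r v
  define \<mu> where "\<mu> = \<rho> * (2 / c) ^ Suc n"
  have \<mu>: "0 < \<mu>" using assms c by (simp add: \<mu>_def)
  assume r: "0 < r"
    and "mass {x. \<rho> * (2 / c) ^ n < infdist (- x) E} v (v + r) \<le> (1 - (\<sigma> + \<tau>) / 2) * r"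
  then have "mass {x. \<rho> * (2 / c) ^ n < infdist x E} (- v - r) (- v) \<le> (1 - (\<sigma> + \<tau>) / 2) * r"
    using mass_reflect[of "{x. \<rho> * (2 / c) ^ n < infdist x E}" v "v + r"]
    by (simp add: borel_open)
  moreover have "mass {x. c * \<mu> \<le> infdist x E} (- v - r) (- v)
      \<le> mass {x. \<rho> * (2 / c) ^ n < infdist x E} (- v - r) (- v)"
    by (rule mass_mono) (use less pos in \<open>auto simp: \<mu>_def\<close>)
  moreover have "(1 - (\<sigma> + \<tau>) / 2) * r < (1 - \<sigma>) * r"
    by (rule mult_strict_right_mono) (use thresholds r in auto)
  ultimately have "\<sigma> * r < mass {x. infdist x E < c * \<mu>} (- v - r) (- v)"
    using mass_far_eq[of "- v - r" "- v" "c * \<mu>" E] r unfolding left_diff_distrib mult_1 by linarith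
  then have "\<tau> * r < mass {x. infdist x E < \<mu>} (- v) (- v + r)"
    using transfer[OF \<mu> r, of "- v"] by fastforce
  then have "mass {x. \<mu> \<le> infdist x E} (- v) (- v + r) \<le> (1 - \<tau>) * r"
    using mass_far_eq[of "- v" "- v + r" \<mu> E] r by (simp add: algebra_simps)
  moreover have "mass {x. \<mu> < infdist x E} (- v) (- v + r) \<le> mass {x. \<mu> \<le> infdist x E} (- v) (- v + r)"
    by (rule mass_mono) auto
  ultimately show "mass {x. \<rho> * (2 / c) ^ Suc n < infdist (- x) E} (v - r) v \<le> (1 - \<tau>) * r"
    using mass_reflect[of "{x. \<mu> < infdist x E}" "v - r" v]
    by (simp add: borel_open \<mu>_def)
qed (use thresholds in auto)

end

section \<open>Powers of the distance\<close>

lemma enn_powr_mono: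
  assumes "x \<le> y" "0 < r"
  shows "enn_powr x r \<le> enn_powr y r"
proof (cases "y = \<infinity>")
  case False
  then have "enn2real x \<le> enn2real y" "x \<noteq> \<infinity>"
    using assms by (auto intro!: enn2real_mono simp: top_unique less_top)
  then show ?thesis using assms False
    by (auto simp: enn_powr_def intro!: ennreal_leI powr_mono2)
qed (use assms in \<open>auto simp: enn_powr_def\<close>)

lemma enn_powr_ennreal: "0 < x \<Longrightarrow> enn_powr (ennreal x) r = ennreal (x powr r)"
  by (auto simp: enn_powr_def)

lemma dist_powr_uminus:
  "0 < \<alpha> \<Longrightarrow> dist_powr E (- \<alpha>) x = (if infdist x E = 0 then \<infinity> else ennreal (infdist x E powr - \<alpha>))"
  using infdist_nonneg[of x E] by (auto simp: dist_powr_def enn_powr_def)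

lemma enn_powr_dist_powr_dual:
  assumes "0 < \<alpha>" "1 < p"
  shows "enn_powr (dist_powr E (- \<alpha>) x) (- 1 / (p - 1)) = ennreal (infdist x E powr (\<alpha> / (p - 1)))"
proof (cases "infdist x E = 0")
  case True
  then show ?thesis using assms by (simp add: dist_powr_uminus enn_powr_def)
next
  case False
  then have "0 < infdist x E" using infdist_nonneg[of x E] by linarith
  then show ?thesis using assms False
    by (simp add: dist_powr_uminus enn_powr_ennreal powr_powr)
qed

lemma borel_measurable_dist_powr [measurable]:
  assumes "0 < \<alpha>"
  shows "dist_powr E (- \<alpha>) \<in> borel_measurable borel"
proof -
  have [measurable]: "(\<lambda>x. infdist x E) \<in> borel_measurable borel"
    by (intro borel_measurable_continuous_onI continuous_intros)
  have "(\<lambda>x. if infdist x E = 0 then \<infinity> else ennreal (infdist x E powr - \<alpha>)) \<in> borel_measurable borel"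
    by measurable
  then show ?thesis using dist_powr_uminus[OF assms] by (simp cong: measurable_cong)
qed

lemma dist_powr_pos: "0 < \<alpha> \<Longrightarrow> 0 < dist_powr E (- \<alpha>) x"
  by (auto simp: dist_powr_uminus)

section \<open>Integral bounds from the decay of level sets\<close>

text \<open>
  The layer cake principle with geometric levels. A point outside all \<open>S i\<close> contributes at most \<open>\<mu>\<close>; one
  that lies in \<open>S k\<close> but not in \<open>S (k + 1)\<close> has \<open>g x \<le> \<mu> * \<Lambda> ^ (k + 1)\<close>, which is charged to \<open>S k\<close>. The
  sum over \<open>k\<close> is geometric with ratio \<open>\<Lambda> * \<theta>\<close>.
\<close>

lemma nn_integral_le_if_levels_decay:
  fixes g :: "real \<Rightarrow> ennreal"
  assumes K: "emeasure lebesgue K \<le> ennreal \<kappa>" "K \<in> sets lebesgue" and S: "\<And>i. S i \<in> sets lebesgue"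
    and level: "\<And>i x. x \<notin> S i \<Longrightarrow> g x \<le> ennreal (\<mu> * \<Lambda> ^ i)"
    and decay: "\<And>i. emeasure lebesgue (S i \<inter> K) \<le> ennreal (M * \<theta> ^ i)"
    and pos: "0 < \<mu>" "1 \<le> \<Lambda>" "0 \<le> \<theta>" "\<Lambda> * \<theta> < 1" "0 \<le> M" "0 \<le> \<kappa>"
  shows "(\<integral>\<^sup>+x\<in>K. g x \<partial>lebesgue) \<le> ennreal (\<mu> * (\<kappa> + \<Lambda> * M / (1 - \<Lambda> * \<theta>)))"
proof -
  define f where "f i = \<mu> * \<Lambda> ^ Suc i" for i
  have f: "\<mu> \<le> f i" "0 \<le> f i" for i
  proof -
    have "\<mu> * 1 \<le> \<mu> * \<Lambda> ^ Suc i" by (intro mult_left_mono one_le_power) (use pos in auto)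
    then show "\<mu> \<le> f i" by (simp add: f_def)
    then show "0 \<le> f i" using pos by simp
  qed
  have single: "h i \<le> (\<Sum>i. h i)" for h :: "nat \<Rightarrow> ennreal" and i
    using sum_le_suminf[of h "{i}"] by simp
  have layer: "g x \<le> ennreal \<mu> + (\<Sum>i. ennreal (f i) * indicator (S i) x)" for x
  proof (cases "\<exists>i. x \<notin> S i")
    case True
    define i where "i = (LEAST i. x \<notin> S i)"
    have i: "x \<notin> S i" unfolding i_def using True by (metis LeastI)
    show ?thesis
    proof (cases i)
      case 0
      then have "g x \<le> ennreal \<mu>" using level[OF i] by simp
      then show ?thesis by (simp add: add_increasing2)
    next
      case (Suc k)
      then have "x \<in> S k" unfolding i_def using not_less_Least[of k "\<lambda>i. x \<notin> S i"] by auto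
      then have "g x \<le> ennreal (f k) * indicator (S k) x"
        using level[OF i] Suc by (simp add: f_def)
      also have "\<dots> \<le> (\<Sum>i. ennreal (f i) * indicator (S i) x)" by (rule single)
      finally show ?thesis by (simp add: add_increasing)
    qed
  next
    case False
    \<comment> \<open>A point in all \<open>S i\<close>, where \<open>g x\<close> may be infinite: the right-hand side is infinite as well.\<close>
    have "ennreal (of_nat n * \<mu>) \<le> (\<Sum>i. ennreal (f i) * indicator (S i) x)" for n
    proof -
      have "ennreal (of_nat n * \<mu>) = (\<Sum>i<n. ennreal \<mu>)"
        using pos by (simp add: ennreal_mult ennreal_of_nat_eq_real_of_nat)
      also have "\<dots> \<le> (\<Sum>i<n. ennreal (f i) * indicator (S i) x)"
        using False f by (intro sum_mono) (simp add: ennreal_leI)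
      also have "\<dots> \<le> (\<Sum>i. ennreal (f i) * indicator (S i) x)"
        by (rule sum_le_suminf) auto
      finally show ?thesis .
    qed
    moreover have "\<exists>n. z < real n * \<mu>" for z
      using reals_Archimedean3[OF pos(1)] by blast
    ultimately have "(\<Sum>i. ennreal (f i) * indicator (S i) x) = top"
      by (metis ennreal_cases ennreal_less_iff enn2real_nonneg linorder_not_less pos(1)
          enn2real_ennreal ennreal_leI less_eq_real_def)
    then show ?thesis by simp
  qed
  have "(\<integral>\<^sup>+x\<in>K. g x \<partial>lebesgue) \<le>
      (\<integral>\<^sup>+x. ennreal \<mu> * indicator K x + (\<Sum>i. ennreal (f i) * indicator (S i \<inter> K) x) \<partial>lebesgue)"
  proof (rule nn_integral_mono)
    show "g x * indicator K x \<le>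
        ennreal \<mu> * indicator K x + (\<Sum>i. ennreal (f i) * indicator (S i \<inter> K) x)" for x
      using layer[of x] by (cases "x \<in> K") (auto simp: indicator_inter_arith)
  qed
  also have "\<dots> = ennreal \<mu> * emeasure lebesgue K + (\<Sum>i. ennreal (f i) * emeasure lebesgue (S i \<inter> K))"
    using K S by (subst nn_integral_add) (auto simp: nn_integral_suminf nn_integral_cmult_indicator)
  also have "\<dots> \<le> ennreal \<mu> * ennreal \<kappa> + (\<Sum>i. ennreal (f i) * ennreal (M * \<theta> ^ i))"
    by (intro add_mono mult_left_mono suminf_le K decay) auto
  also have "(\<Sum>i. ennreal (f i) * ennreal (M * \<theta> ^ i)) = (\<Sum>i. ennreal (\<mu> * \<Lambda> * M * (\<Lambda> * \<theta>) ^ i))"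
    using pos by (simp add: f_def ennreal_mult[symmetric] power_mult_distrib mult_ac)
  also have "\<dots> = ennreal (\<mu> * \<Lambda> * M * (1 / (1 - \<Lambda> * \<theta>)))"
  proof (rule suminf_ennreal_eq)
    show "(\<lambda>i. \<mu> * \<Lambda> * M * (\<Lambda> * \<theta>) ^ i) sums (\<mu> * \<Lambda> * M * (1 / (1 - \<Lambda> * \<theta>)))"
      by (intro sums_mult geometric_sums) (use pos in simp)
  qed (use pos in simp)
  also have "ennreal \<mu> * ennreal \<kappa> + \<dots> = ennreal (\<mu> * (\<kappa> + \<Lambda> * M / (1 - \<Lambda> * \<theta>)))"
    using pos by (simp add: ennreal_mult[symmetric] ennreal_plus[symmetric] algebra_simps del: ennreal_plus)
  finally show ?thesis .
qed

lemma emeasure_Int_eq_mass: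
  "A \<in> sets lebesgue \<Longrightarrow> emeasure lebesgue (A \<inter> {u<..<v}) = ennreal (mass A u v)"
  unfolding mass_def by (rule emeasure_eq_measure2) auto

context distance_transfer
begin

text \<open>
  Decay to the left for the levels \<open>d < \<rho> (c / 2)\<^sup>i\<close>, with \<open>j = 3\<close>: the interval \<open>(u - 8 * r, u - r)\<close>
  contains \<open>(u - 6 * r, u - 2 * r)\<close>, which is the dyadic piece that corresponds to the interval
  \<open>(u, u + r)\<close> with \<open>u + 2 * r\<close> as the centre.
\<close>

lemma near_integral:
  assumes shift: "decay_shift \<sigma> \<tau> m" and "0 < \<alpha>"
    and \<Lambda>: "\<Lambda> = (2 / c) powr \<alpha>" "\<Lambda> * (\<sigma> / \<tau>) < 1"
    and "0 < \<rho>" "0 < r" and density: "mass {x. infdist x E < \<rho>} u (u + r) \<le> \<tau> * r"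
  shows "(\<integral>\<^sup>+x\<in>{u - 6 * r<..<u - 2 * r}. dist_powr E (- \<alpha>) x \<partial>lebesgue) \<le>
    ennreal (\<rho> powr - \<alpha> * \<Lambda> ^ (4 * m) * (4 * r + \<Lambda> * (8 * r) / (1 - \<Lambda> * (\<sigma> / \<tau>))))"
proof (rule nn_integral_le_if_levels_decay)
  define S where "S i = {x. infdist x E < \<rho> * (c / 2) ^ i}" for i
  show "emeasure lebesgue {u - 6 * r<..<u - 2 * r} \<le> ennreal (4 * r)"
    using \<open>0 < r\<close> by simp
  show "S (4 * m + i) \<in> sets lebesgue" for i by (simp add: S_def)
  show "dist_powr E (- \<alpha>) x \<le> ennreal (\<rho> powr - \<alpha> * \<Lambda> ^ (4 * m) * \<Lambda> ^ i)" if "x \<notin> S (4 * m + i)" for i x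
  proof -
    define n where "n = 4 * m + i"
    have d: "0 < \<rho> * (c / 2) ^ n" "\<rho> * (c / 2) ^ n \<le> infdist x E"
      using that c \<open>0 < \<rho>\<close> by (auto simp: S_def n_def)
    then have "infdist x E powr - \<alpha> \<le> (\<rho> * (c / 2) ^ n) powr - \<alpha>"
      using \<open>0 < \<alpha>\<close> by (intro powr_mono2') auto
    also have "\<dots> = \<rho> powr - \<alpha> * \<Lambda> ^ n"
      using c \<open>0 < \<rho>\<close>
      by (simp add: \<Lambda>(1) powr_mult powr_power powr_powr powr_minus powr_divide
          powr_realpow[symmetric] field_simps)
    finally show ?thesis using d \<open>0 < \<alpha>\<close>
      by (auto simp: dist_powr_uminus n_def power_add mult_ac intro!: ennreal_leI)
  qed
  show "emeasure lebesgue (S (4 * m + i) \<inter> {u - 6 * r<..<u - 2 * r}) \<le> ennreal (8 * r * (\<sigma> / \<tau>) ^ i)" for i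
  proof -
    have S: "S n \<in> sets lebesgue" for n by (simp add: S_def)
    have "mass (S (4 * m + i)) (u - 6 * r) (u - 2 * r) \<le> mass (S (m * (3 + 1) + i)) (u - 2 ^ 3 * r) (u - r)"
      by (rule mass_mono[OF _ _ _ S S]) (use \<open>0 < r\<close> in \<open>auto simp: mult.commute\<close>)
    also have "\<dots> \<le> (\<sigma> / \<tau>) ^ i * (2 ^ 3 * r)"
      using shift porous_cascade_near[OF \<open>0 < \<rho>\<close>] \<open>0 < r\<close> density
      unfolding decay_shift_def S_def by fastforce
    finally show ?thesis unfolding emeasure_Int_eq_mass[OF S]
      by (intro ennreal_leI) (simp add: mult_ac)
  qed
  show "0 < \<rho> powr - \<alpha> * \<Lambda> ^ (4 * m)" using \<open>0 < \<rho>\<close> c by (simp add: \<Lambda>(1))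
  show "1 \<le> \<Lambda>" unfolding \<Lambda>(1) by (rule ge_one_powr_ge_zero) (use c \<open>0 < \<alpha>\<close> in auto)
qed (use \<Lambda> thresholds \<open>0 < r\<close> in auto)

text \<open>
  Decay to the right for the levels \<open>d > \<rho> (2 / c)\<^sup>i\<close>, by reflection. The first \<open>m * (j + 1)\<close> levels,
  where there is no decay yet, only enter through the factor \<open>\<Lambda> ^ (m * (j + 1))\<close>.
\<close>

lemma far_integral:
  defines "\<theta>' \<equiv> (1 - \<tau>) / (1 - (\<sigma> + \<tau>) / 2)"
  assumes shift: "decay_shift (1 - \<tau>) (1 - (\<sigma> + \<tau>) / 2) m" and "0 < \<beta>"
    and \<Lambda>: "\<Lambda> = (2 / c) powr \<beta>" "\<Lambda> * \<theta>' < 1"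
    and "0 < \<rho>" "0 < r" and density: "\<tau> * r < mass {x. infdist x E < \<rho>} u (u + r)"
  shows "(\<integral>\<^sup>+x\<in>{u + 2 * r<..<u + r + 2 ^ j * r}. ennreal (infdist x E powr \<beta>) \<partial>lebesgue) \<le>
    ennreal (\<rho> powr \<beta> * \<Lambda> ^ (m * (j + 1)) * (2 ^ j * r + \<Lambda> * (2 ^ j * r) / (1 - \<Lambda> * \<theta>')))"
proof (rule nn_integral_le_if_levels_decay)
  define S where "S i = {x. \<rho> * (2 / c) ^ i < infdist x E}" for i
  show "emeasure lebesgue {u + 2 * r<..<u + r + 2 ^ j * r} \<le> ennreal (2 ^ j * r)"
  proof (cases "u + 2 * r \<le> u + r + 2 ^ j * r")
    case True
    then show ?thesis using \<open>0 < r\<close> by (auto intro!: ennreal_leI)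
  qed simp
  show "S (m * (j + 1) + i) \<in> sets lebesgue" for i by (simp add: S_def)
  show "ennreal (infdist x E powr \<beta>) \<le> ennreal (\<rho> powr \<beta> * \<Lambda> ^ (m * (j + 1)) * \<Lambda> ^ i)"
    if "x \<notin> S (m * (j + 1) + i)" for i x
  proof -
    define n where "n = m * (j + 1) + i"
    have d: "infdist x E \<le> \<rho> * (2 / c) ^ n"
      using that by (auto simp: S_def n_def)
    then have "infdist x E powr \<beta> \<le> (\<rho> * (2 / c) ^ n) powr \<beta>"
      using \<open>0 < \<beta>\<close> by (intro powr_mono2) (auto simp: infdist_nonneg)
    also have "\<dots> = \<rho> powr \<beta> * \<Lambda> ^ n"
      using c \<open>0 < \<rho>\<close>
      by (simp add: \<Lambda>(1) powr_mult powr_power powr_powr powr_realpow[symmetric] mult.commute)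
    finally show ?thesis by (auto simp: n_def power_add mult_ac intro!: ennreal_leI)
  qed
  show "emeasure lebesgue (S (m * (j + 1) + i) \<inter> {u + 2 * r<..<u + r + 2 ^ j * r})
      \<le> ennreal (2 ^ j * r * \<theta>' ^ i)" for i
  proof -
    have S: "S n \<in> sets borel" "S n \<in> sets lebesgue" for n by (auto simp: S_def borel_open)
    have refl: "{x. \<rho> * (2 / c) ^ n < infdist (- x) E} = {x. - x \<in> S n}" for n by (simp add: S_def)
    have "mass {x. \<rho> \<le> infdist x E} u (u + r) \<le> (1 - \<tau>) * r"
      using mass_far_eq[of u "u + r" \<rho> E] density \<open>0 < r\<close> by (simp add: algebra_simps)
    moreover have "mass (S 0) u (u + r) \<le> mass {x. \<rho> \<le> infdist x E} u (u + r)"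
      by (rule mass_mono) (auto simp: S_def)
    moreover have "(1 - \<tau>) * r \<le> (1 - (\<sigma> + \<tau>) / 2) * r"
      using thresholds \<open>0 < r\<close> by (intro mult_right_mono) auto
    ultimately have "mass (S 0) u (u + r) \<le> (1 - (\<sigma> + \<tau>) / 2) * r" by linarith
    then have start: "mass {x. - x \<in> S 0} (- u - r) (- u - r + r) \<le> (1 - (\<sigma> + \<tau>) / 2) * r"
      by (simp add: mass_reflect[OF S(1)] add.commute)
    have "mass {x. - x \<in> S (m * (j + 1) + i)} (- u - r - 2 ^ j * r) (- u - r - r)
        \<le> \<theta>' ^ i * (2 ^ j * r)"
      using shift porous_cascade_far[OF \<open>0 < \<rho>\<close>] \<open>0 < r\<close> start
      unfolding decay_shift_def refl \<theta>'_def by blast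
    then have "mass (S (m * (j + 1) + i)) (u + 2 * r) (u + r + 2 ^ j * r) \<le> \<theta>' ^ i * (2 ^ j * r)"
      by (simp add: mass_reflect[OF S(1)] algebra_simps)
    then show ?thesis unfolding emeasure_Int_eq_mass[OF S(2)]
      by (intro ennreal_leI) (simp add: mult_ac)
  qed
  show "0 < \<rho> powr \<beta> * \<Lambda> ^ (m * (j + 1))" using \<open>0 < \<rho>\<close> c by (simp add: \<Lambda>(1))
  show "1 \<le> \<Lambda>" unfolding \<Lambda>(1) by (rule ge_one_powr_ge_zero) (use c \<open>0 < \<beta>\<close> in auto)
  show "0 \<le> \<theta>'" unfolding \<theta>'_def using thresholds by (intro divide_nonneg_nonneg) auto
qed (use \<Lambda> \<open>0 < r\<close> in auto)

text \<open>
  A number \<open>\<rho>\<close> that makes \<open>(u, u + r)\<close> a starting interval both for decay to the left (of \<open>d < \<rho>\<close>) and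
  for decay to the right (of \<open>d > 2 * \<rho>\<close>).
\<close>

lemma exists_quantile:
  assumes "0 < r"
  obtains \<rho> where "0 < \<rho>" "mass {x. infdist x E < \<rho>} u (u + r) \<le> \<tau> * r"
    "\<tau> * r < mass {x. infdist x E < 2 * \<rho>} u (u + r)"
proof -
  define R where "R = {\<rho>. 0 < \<rho> \<and> mass {x. infdist x E < \<rho>} u (u + r) \<le> \<tau> * r}"
  have "R \<noteq> {}" using small[OF assms, of u] by (auto simp: R_def)
  have "\<rho> \<le> infdist u E + r" if "\<rho> \<in> R" for \<rho>
  proof (rule ccontr)
    assume "\<not> \<rho> \<le> infdist u E + r"
    have "infdist x E < \<rho>" if "u < x" "x < u + r" for x
      using infdist_triangle[of x E u] that \<open>\<not> \<rho> \<le> infdist u E + r\<close> by (simp add: dist_real_def)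
    then have "mass {x. infdist x E < \<rho>} u (u + r) = (u + r) - u"
      by (intro mass_full) (use \<open>0 < r\<close> in auto)
    moreover have "\<tau> * r < 1 * r" using thresholds \<open>0 < r\<close> by (intro mult_strict_right_mono) auto
    ultimately show False using that by (simp add: R_def)
  qed
  then have bdd: "bdd_above R" by (rule bdd_aboveI)
  have "0 < Sup R"
    using \<open>R \<noteq> {}\<close> cSup_upper[OF _ bdd] by (force simp: R_def)
  then obtain \<rho> where \<rho>: "\<rho> \<in> R" "Sup R / 2 < \<rho>"
    using less_cSup_iff[OF \<open>R \<noteq> {}\<close> bdd, of "Sup R / 2"] by auto
  then have "2 * \<rho> \<notin> R" using cSup_upper[OF _ bdd, of "2 * \<rho>"] by auto
  then show thesis using that[of \<rho>] \<rho> by (auto simp: R_def)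
qed

end

section \<open>Right median porosity yields a one-sided Muckenhoupt weight\<close>

text \<open>
  The three conditions ask, in this order, that the integrals of the weight and of its dual converge,
  and that the sum over the dyadic pieces does.
\<close>

lemma exists_small_exponent:
  fixes G \<theta> \<theta>' q :: real
  assumes "0 < G" "\<theta> < 1" "\<theta>' < 1"
  obtains \<alpha> where "0 < \<alpha>" "G powr \<alpha> * \<theta> < 1" "G powr (\<alpha> / q) * \<theta>' < 1" "(G powr \<alpha>) ^ m \<le> 3 / 2"
proof -
  have 0: "((\<lambda>\<alpha>. \<alpha>) \<longlongrightarrow> 0) (at_right (0::real))" by (rule tendsto_ident_at)
  have 1: "((\<lambda>\<alpha>. G powr (\<alpha> / q)) \<longlongrightarrow> 1) (at_right 0)" for q
  proof -
    have "((\<lambda>\<alpha>. G powr (\<alpha> / q)) \<longlongrightarrow> G powr (0 / q)) (at_right 0)"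
    proof (cases "q = 0")
      case False
      then show ?thesis using assms by (intro tendsto_intros 0) auto
    qed simp
    then show ?thesis using assms by simp
  qed
  have "((\<lambda>\<alpha>. G powr \<alpha> * \<theta>) \<longlongrightarrow> 1 * \<theta>) (at_right 0)"
    using 1[of 1] by (intro tendsto_intros) simp
  then have a: "eventually (\<lambda>\<alpha>. G powr \<alpha> * \<theta> < 1) (at_right 0)"
    by (rule order_tendstoD) (use assms in simp)
  have "((\<lambda>\<alpha>. G powr (\<alpha> / q) * \<theta>') \<longlongrightarrow> 1 * \<theta>') (at_right 0)"
    by (intro tendsto_intros 1)
  then have b: "eventually (\<lambda>\<alpha>. G powr (\<alpha> / q) * \<theta>' < 1) (at_right 0)"
    by (rule order_tendstoD) (use assms in simp)
  have "((\<lambda>\<alpha>. (G powr \<alpha>) ^ m) \<longlongrightarrow> 1 ^ m) (at_right 0)"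
    using 1[of 1] by (intro tendsto_intros) simp
  then have c: "eventually (\<lambda>\<alpha>. (G powr \<alpha>) ^ m < 3 / 2) (at_right 0)"
    by (rule order_tendstoD) simp
  have "eventually (\<lambda>\<alpha>::real. 0 < \<alpha>) (at_right 0)" by (rule eventually_at_right_less)
  with a b c have "eventually (\<lambda>\<alpha>. 0 < \<alpha> \<and> G powr \<alpha> * \<theta> < 1 \<and> G powr (\<alpha> / q) * \<theta>' < 1 \<and>
      (G powr \<alpha>) ^ m \<le> 3 / 2) (at_right 0)"
    by eventually_elim auto
  then show thesis
    using eventually_happens[of _ "at_right (0::real)"] that by auto
qed

lemma nn_integral_left_half_le_suminf:
  fixes g :: "real \<Rightarrow> ennreal"
  assumes g: "g \<in> borel_measurable lebesgue" and "0 < h"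
  shows "(\<integral>\<^sup>+x\<in>{v - h<..<v}. g x \<partial>lebesgue) \<le>
    (\<Sum>l. \<integral>\<^sup>+x\<in>{v - h / 2 ^ l<..<v - h / 2 ^ Suc l}. g x \<partial>lebesgue)"
proof -
  define K where "K l = {v - h / 2 ^ l<..v - h / 2 ^ Suc l}" for l
  have cover: "g x * indicator {v - h<..<v} x \<le> (\<Sum>l. g x * indicator (K l) x)" for x
  proof (cases "x \<in> {v - h<..<v}")
    case True
    define P where "P l \<longleftrightarrow> h / 2 ^ l \<le> v - x" for l :: nat
    have "\<exists>l. P l"
    proof -
      obtain l where "(1 / 2) ^ l < (v - x) / h"
        using real_arch_pow_inv[of "(v - x) / h" "1 / 2"] True \<open>0 < h\<close> by auto
      then have "P l" using \<open>0 < h\<close> by (auto simp: P_def field_simps)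
      then show ?thesis ..
    qed
    then have least: "P (LEAST l. P l)" by (rule LeastI_ex)
    moreover have "\<not> P 0" using True by (simp add: P_def)
    ultimately obtain k where k: "(LEAST l. P l) = Suc k" by (metis not0_implies_Suc)
    then have "\<not> P k" using not_less_Least[of k P] by simp
    then have "x \<in> K k" using least k by (auto simp: K_def P_def)
    then show ?thesis
      using sum_le_suminf[of "\<lambda>l. g x * indicator (K l) x" "{k}"] True by simp
  qed simp
  have "(\<integral>\<^sup>+x\<in>{v - h<..<v}. g x \<partial>lebesgue) \<le> (\<integral>\<^sup>+x. (\<Sum>l. g x * indicator (K l) x) \<partial>lebesgue)"
    by (rule nn_integral_mono) (rule cover)
  also have "\<dots> = (\<Sum>l. \<integral>\<^sup>+x. g x * indicator (K l) x \<partial>lebesgue)"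
    by (rule nn_integral_suminf)
      (use g in \<open>auto intro!: borel_measurable_times_ennreal borel_measurable_indicator simp: K_def\<close>)
  also have "\<dots> = (\<Sum>l. \<integral>\<^sup>+x\<in>{v - h / 2 ^ l<..<v - h / 2 ^ Suc l}. g x \<partial>lebesgue)"
  proof (rule suminf_cong, rule nn_integral_cong_AE)
    fix l
    have "AE x in lebesgue. x \<noteq> v - h / 2 ^ Suc l"
      by (rule AE_I[where N="{v - h / 2 ^ Suc l}"]) auto
    then show "AE x in lebesgue. g x * indicator (K l) x =
        g x * indicator {v - h / 2 ^ l<..<v - h / 2 ^ Suc l} x"
      by eventually_elim (auto simp: K_def indicator_def)
  qed
  finally show ?thesis .
qed

lemma Ap_plusI:
  assumes "weight w"
    and "\<And>v h. 0 < h \<Longrightarrow> average {v - h<..<v} w *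
      enn_powr (average {v<..<v + h} (\<lambda>x. enn_powr (w x) (- 1 / (p - 1)))) (p - 1) \<le> ennreal C"
  shows "w \<in> Ap_plus p"
proof -
  have "average {a<..<(a + b) / 2} w *
      enn_powr (average {(a + b) / 2<..<b} (\<lambda>x. enn_powr (w x) (- 1 / (p - 1)))) (p - 1) \<le> ennreal C"
    if "a < b" for a b
  proof -
    have "(a + b) / 2 - (b - a) / 2 = a" "(a + b) / 2 + (b - a) / 2 = b" by (auto simp: field_simps)
    then show ?thesis using assms(2)[of "(b - a) / 2" "(a + b) / 2"] that by simp
  qed
  then have "(SUP (a, b) \<in> {(a, b). a < b}. average {a <..< (a + b) / 2} w *
        enn_powr (average {(a + b) / 2 <..< b} (\<lambda>x. enn_powr (w x) (- 1 / (p - 1)))) (p - 1)) \<le> ennreal C"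
    by (intro SUP_least) auto
  then show ?thesis using assms(1) le_less_trans[OF _ ennreal_less_top] by (auto simp: Ap_plus_def)
qed

context distance_transfer
begin

text \<open>
  For each dyadic piece the quantile \<open>\<rho>\<close> depends on the piece, but the same \<open>\<rho>\<close> enters the bound of
  the dual average with the opposite exponent. So the product is estimated piece by piece, before the
  sum is taken.
\<close>

theorem exists_dist_powr_in_Ap_plus:
  assumes "1 < p"
  shows "\<exists>\<alpha>>0. dist_powr E (- \<alpha>) \<in> Ap_plus p"
proof -
  define \<theta> where "\<theta> = \<sigma> / \<tau>"
  define \<theta>' where "\<theta>' = (1 - \<tau>) / (1 - (\<sigma> + \<tau>) / 2)"
  have \<theta>: "0 < \<theta>" "\<theta> < 1" "0 < \<theta>'" "\<theta>' < 1" using thresholds by (auto simp: \<theta>_def \<theta>'_def)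
  obtain m where m: "decay_shift \<sigma> \<tau> m" using exists_decay_shift thresholds by blast
  obtain n where n: "decay_shift (1 - \<tau>) (1 - (\<sigma> + \<tau>) / 2) n"
    using exists_decay_shift[of "1 - \<tau>" "1 - (\<sigma> + \<tau>) / 2"] thresholds by auto
  define G where "G = 2 / c"
  have "0 < G" using c by (simp add: G_def)
  obtain \<alpha> where \<alpha>: "0 < \<alpha>" and small_\<alpha>: "G powr \<alpha> * \<theta> < 1" "G powr (\<alpha> / (p - 1)) * \<theta>' < 1"
    "(G powr \<alpha>) ^ n \<le> 3 / 2"
    using exists_small_exponent[OF \<open>0 < G\<close> \<theta>(2,4), of "p - 1" n] by blast
  \<comment> \<open>The dual weight is \<open>d\<close> to the power \<open>\<beta>\<close>.\<close>
  define \<beta> where "\<beta> = \<alpha> / (p - 1)"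
  have \<beta>: "0 < \<beta>" "\<beta> * (p - 1) = \<alpha>" using \<alpha> assms by (auto simp: \<beta>_def)
  define \<Lambda> where "\<Lambda> = G powr \<alpha>"
  define \<Lambda>' where "\<Lambda>' = G powr \<beta>"
  have \<Lambda>: "0 < \<Lambda>" "\<Lambda> * \<theta> < 1" "\<Lambda> ^ n \<le> 3 / 2" "0 < \<Lambda>'" "\<Lambda>' * \<theta>' < 1" "\<Lambda>' powr (p - 1) = \<Lambda>"
    using small_\<alpha> \<open>0 < G\<close> \<beta> by (auto simp: \<Lambda>_def \<Lambda>'_def \<beta>_def powr_powr)
  define KW where "KW = 4 + \<Lambda> * 8 / (1 - \<Lambda> * \<theta>)"
  define KV where "KV = 2 + \<Lambda>' * 2 / (1 - \<Lambda>' * \<theta>')"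
  have KW: "0 < KW" unfolding KW_def using \<Lambda> by (intro add_pos_pos divide_pos_pos mult_pos_pos) auto
  have KV: "0 < KV" unfolding KV_def using \<Lambda> by (intro add_pos_pos divide_pos_pos mult_pos_pos) auto
  let ?w = "dist_powr E (- \<alpha>)"
  have near: "(\<integral>\<^sup>+x\<in>{u - 6 * r<..<u - 2 * r}. ?w x \<partial>lebesgue) \<le> ennreal (\<rho> powr - \<alpha> * \<Lambda> ^ (4 * m) * (KW * r))"
    if "0 < \<rho>" "0 < r" "mass {x. infdist x E < \<rho>} u (u + r) \<le> \<tau> * r" for \<rho> u r
  proof -
    have "4 * r + \<Lambda> * (8 * r) / (1 - \<Lambda> * \<theta>) = KW * r" by (simp add: KW_def algebra_simps)
    then show ?thesis
      using near_integral[OF m \<alpha> _ _ that, of \<Lambda>] \<Lambda> by (simp add: \<Lambda>_def[symmetric] G_def[symmetric] \<theta>_def[symmetric])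
  qed
  have w_meas: "?w \<in> borel_measurable lebesgue"
    using borel_measurable_dist_powr[OF \<alpha>] by (simp add: measurable_completion)
  have "weight ?w" unfolding weight_def
  proof (intro conjI allI impI w_meas)
    fix K :: "real set" assume "compact K"
    then have "bounded K" by (rule compact_imp_bounded)
    then obtain N where N: "0 < N" "\<And>x. x \<in> K \<Longrightarrow> \<bar>x\<bar> < N"
      unfolding bounded_pos_less by auto
    obtain \<rho> where \<rho>: "0 < \<rho>" "mass {x. infdist x E < \<rho>} (2 * N) (2 * N + N / 2) \<le> \<tau> * (N / 2)"
      using small[of "N / 2" "2 * N"] N by auto
    have "(\<integral>\<^sup>+x\<in>K. ?w x \<partial>lebesgue) \<le> (\<integral>\<^sup>+x\<in>{2 * N - 6 * (N / 2)<..<2 * N - 2 * (N / 2)}. ?w x \<partial>lebesgue)"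
    proof (rule nn_integral_mono)
      show "?w x * indicator K x \<le> ?w x * indicator {2 * N - 6 * (N / 2)<..<2 * N - 2 * (N / 2)} x" for x
        using N(2)[of x] by (auto simp: indicator_def)
    qed
    also have "\<dots> \<le> ennreal (\<rho> powr - \<alpha> * \<Lambda> ^ (4 * m) * (KW * (N / 2)))"
      by (rule near) (use \<rho> N in auto)
    finally show "(\<integral>\<^sup>+x\<in>K. ?w x \<partial>lebesgue) < \<infinity>"
      using le_less_trans[OF _ ennreal_less_top] by auto
  qed (use dist_powr_pos[OF \<alpha>] in auto)
  define C where "C = \<Lambda> ^ (4 * m) * KW * 2 powr \<alpha> * \<Lambda> ^ (5 * n) * KV powr (p - 1) / 8"
  have C: "0 \<le> C" unfolding C_def using \<Lambda> KW by simp
  have "?w \<in> Ap_plus p"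
  proof (rule Ap_plusI[OF \<open>weight ?w\<close>])
    fix v h :: real assume "0 < h"
    define V where "V = average {v<..<v + h} (\<lambda>x. enn_powr (?w x) (- 1 / (p - 1)))"
    define W where "W l = (\<integral>\<^sup>+x\<in>{v - h / 2 ^ l<..<v - h / 2 ^ Suc l}. ?w x \<partial>lebesgue)" for l
    \<comment> \<open>The contribution of the \<open>l\<close>-th dyadic piece to the product of the averages.\<close>
    have bound: "W l / ennreal h * enn_powr V (p - 1) \<le> ennreal (C * (3 / 4) ^ l)" for l
    proof -
      \<comment> \<open>With this choice the \<open>l\<close>-th piece is \<open>(u - 6 * r, u - 2 * r)\<close>, and \<open>v = u + 2 * r\<close>.\<close>
      define r where "r = h / 2 ^ (l + 3)"
      define u where "u = v - 2 * r"
      have r: "0 < r" "h = 8 * 2 ^ l * r" using \<open>0 < h\<close> by (auto simp: r_def power_add)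
      obtain \<rho> where \<rho>: "0 < \<rho>" "mass {x. infdist x E < \<rho>} u (u + r) \<le> \<tau> * r"
        "\<tau> * r < mass {x. infdist x E < 2 * \<rho>} u (u + r)"
        using exists_quantile[OF r(1)] by blast
      have "{v - h / 2 ^ l<..<v - h / 2 ^ Suc l} = {u - 6 * r<..<u - 2 * r}"
        using r by (simp add: u_def)
      then have W: "W l \<le> ennreal (\<rho> powr - \<alpha> * \<Lambda> ^ (4 * m) * (KW * r))"
        unfolding W_def using near[OF \<rho>(1) r(1) \<rho>(2)] by simp
      have "W l / ennreal h \<le> ennreal (\<rho> powr - \<alpha> * \<Lambda> ^ (4 * m) * (KW * r)) / ennreal h"
        by (rule divide_right_mono_ennreal[OF W])
      also have "\<dots> = ennreal (\<rho> powr - \<alpha> * \<Lambda> ^ (4 * m) * (KW * r) / h)"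
        using \<Lambda> KW r \<open>0 < h\<close> by (intro divide_ennreal) auto
      finally have W': "W l / ennreal h \<le> ennreal (\<rho> powr - \<alpha> * \<Lambda> ^ (4 * m) * (KW * r) / h)" .
      define B where "B = (2 * \<rho>) powr \<beta> * \<Lambda>' ^ (n * (l + 5)) * KV"
      have B: "0 < B" using \<rho> \<Lambda> KV by (simp add: B_def)
      \<comment> \<open>The exponent \<open>l + 4\<close> is large enough for \<open>(v, v + h)\<close>, as \<open>2 ^ (l + 4) * r = 2 * h\<close>.\<close>
      have "(\<integral>\<^sup>+x\<in>{v<..<v + h}. enn_powr (?w x) (- 1 / (p - 1)) \<partial>lebesgue) \<le>
          (\<integral>\<^sup>+x\<in>{u + 2 * r<..<u + r + 2 ^ (l + 4) * r}. ennreal (infdist x E powr \<beta>) \<partial>lebesgue)"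
      proof (rule nn_integral_mono)
        have "1 \<le> 8 * (2::real) ^ l" using one_le_power[of "2::real" l] by linarith
        then have "1 * r \<le> 8 * 2 ^ l * r" using r(1) by (intro mult_right_mono) auto
        then have "r \<le> 8 * 2 ^ l * r" by simp
        then show "enn_powr (?w x) (- 1 / (p - 1)) * indicator {v<..<v + h} x \<le>
            ennreal (infdist x E powr \<beta>) * indicator {u + 2 * r<..<u + r + 2 ^ (l + 4) * r} x" for x
          unfolding enn_powr_dist_powr_dual[OF \<alpha> assms] \<beta>_def[symmetric]
          using r(2) by (auto simp: u_def power_add indicator_def)
      qed
      also have "\<dots> \<le> ennreal ((2 * \<rho>) powr \<beta> * \<Lambda>' ^ (n * (l + 4 + 1)) *
          (2 ^ (l + 4) * r + \<Lambda>' * (2 ^ (l + 4) * r) / (1 - \<Lambda>' * \<theta>')))"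
        unfolding \<theta>'_def
        by (rule far_integral[OF n \<beta>(1)])
          (use \<rho> r \<Lambda> in \<open>auto simp: \<Lambda>'_def G_def \<theta>'_def\<close>)
      also have "2 ^ (l + 4) * r + \<Lambda>' * (2 ^ (l + 4) * r) / (1 - \<Lambda>' * \<theta>') = KV * h"
        by (simp add: KV_def r(2) power_add algebra_simps)
      also have "(2 * \<rho>) powr \<beta> * \<Lambda>' ^ (n * (l + 4 + 1)) * (KV * h) = B * h"
        by (simp add: B_def add.commute add.left_commute)
      finally have "V \<le> ennreal (B * h) / ennreal h"
        unfolding V_def average_def using \<open>0 < h\<close> by (simp add: divide_right_mono_ennreal)
      also have "\<dots> = ennreal B" using \<open>0 < h\<close> B by (subst divide_ennreal) auto
      finally have "enn_powr V (p - 1) \<le> ennreal (B powr (p - 1))"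
        using enn_powr_mono[of V "ennreal B" "p - 1"] assms B by (simp add: enn_powr_ennreal)
      also have "B powr (p - 1) = 2 powr \<alpha> * \<rho> powr \<alpha> * \<Lambda> ^ (n * (l + 5)) * KV powr (p - 1)"
      proof -
        have "(\<Lambda>' ^ (n * (l + 5))) powr (p - 1) = \<Lambda> ^ (n * (l + 5))"
          unfolding \<Lambda>(6)[symmetric] using \<Lambda>(4) by (simp add: powr_power powr_realpow[symmetric] powr_powr mult.commute)
        then show ?thesis using \<rho> \<Lambda> KV \<beta> by (simp add: B_def powr_mult powr_powr)
      qed
      finally have V': "enn_powr V (p - 1) \<le>
          ennreal (2 powr \<alpha> * \<rho> powr \<alpha> * \<Lambda> ^ (n * (l + 5)) * KV powr (p - 1))" .
      have "W l / ennreal h * enn_powr V (p - 1) \<le>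
          ennreal ((\<rho> powr - \<alpha> * \<Lambda> ^ (4 * m) * (KW * r) / h) *
          (2 powr \<alpha> * \<rho> powr \<alpha> * \<Lambda> ^ (n * (l + 5)) * KV powr (p - 1)))"
        using mult_mono[OF W' V'] \<Lambda> by (subst ennreal_mult'') auto
      also have "(\<rho> powr - \<alpha> * \<Lambda> ^ (4 * m) * (KW * r) / h) *
          (2 powr \<alpha> * \<rho> powr \<alpha> * \<Lambda> ^ (n * (l + 5)) * KV powr (p - 1)) =
          (\<rho> powr - \<alpha> * \<rho> powr \<alpha>) * C * (\<Lambda> ^ n / 2) ^ l"
      proof -
        have "\<Lambda> ^ (n * (l + 5)) = \<Lambda> ^ (5 * n) * (\<Lambda> ^ n) ^ l"
          by (simp add: power_add power_mult[symmetric] algebra_simps)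
        moreover have "KW * r / h = KW / (8 * 2 ^ l)" using r by simp
        then have "\<rho> powr - \<alpha> * \<Lambda> ^ (4 * m) * (KW * r) / h =
            \<rho> powr - \<alpha> * \<Lambda> ^ (4 * m) * (KW / (8 * 2 ^ l))"
          by (simp only: times_divide_eq_right[symmetric])
        ultimately show ?thesis by (simp add: C_def power_divide)
      qed
      also have "\<rho> powr - \<alpha> * \<rho> powr \<alpha> = 1" using \<rho> by (simp add: powr_minus)
      also have "1 * C * (\<Lambda> ^ n / 2) ^ l \<le> 1 * C * (3 / 4) ^ l"
        using C \<Lambda> by (intro mult_left_mono power_mono) auto
      finally show ?thesis by (simp add: ennreal_leI)
    qed
    have "average {v - h<..<v} ?w \<le> (\<Sum>l. W l) / ennreal h"
      unfolding average_def W_def using nn_integral_left_half_le_suminf[OF w_meas \<open>0 < h\<close>] \<open>0 < h\<close>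
      by (simp add: divide_right_mono_ennreal)
    then have "average {v - h<..<v} ?w * enn_powr V (p - 1) \<le> (\<Sum>l. W l) / ennreal h * enn_powr V (p - 1)"
      by (rule mult_right_mono) simp
    also have "\<dots> = (\<Sum>l. W l / ennreal h * enn_powr V (p - 1))" by simp
    also have "\<dots> \<le> (\<Sum>l. ennreal (C * (3 / 4) ^ l))"
      by (rule suminf_le) (use bound in auto)
    also have "\<dots> = ennreal (C * (1 / (1 - 3 / 4)))"
      proof (rule suminf_ennreal_eq)
      show "(\<lambda>l. C * (3 / 4) ^ l) sums (C * (1 / (1 - 3 / 4)))"
        by (intro sums_mult geometric_sums) simp
    qed (use C in simp)
    finally show "average {v - h<..<v} ?w *
        enn_powr (average {v<..<v + h} (\<lambda>x. enn_powr (?w x) (- 1 / (p - 1)))) (p - 1) \<le> ennreal (C * (1 / (1 - 3 / 4)))"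
      unfolding V_def .
  qed
  with \<alpha> show ?thesis by blast
qed

end

section \<open>A one-sided Muckenhoupt weight yields right median porosity\<close>

lemma chebyshev_dist_powr:
  assumes "0 < \<alpha>" "0 < \<kappa>"
  shows "ennreal (\<kappa> powr - \<alpha> * mass {x. infdist x E < \<kappa>} u v) \<le>
    (\<integral>\<^sup>+x\<in>{u<..<v}. dist_powr E (- \<alpha>) x \<partial>lebesgue)"
proof -
  let ?N = "{x. infdist x E < \<kappa>} \<inter> {u<..<v}"
  have N: "?N \<in> sets lebesgue" by (intro sets.Int infdist_level_sets) auto
  have "ennreal (\<kappa> powr - \<alpha> * mass {x. infdist x E < \<kappa>} u v) = (\<integral>\<^sup>+x. ennreal (\<kappa> powr - \<alpha>) * indicator ?N x \<partial>lebesgue)"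
    by (subst nn_integral_cmult_indicator[OF N], subst emeasure_Int_eq_mass)
      (auto simp: ennreal_mult)
  also have "\<dots> \<le> (\<integral>\<^sup>+x\<in>{u<..<v}. dist_powr E (- \<alpha>) x \<partial>lebesgue)"
  proof (rule nn_integral_mono)
    fix x
    show "ennreal (\<kappa> powr - \<alpha>) * indicator ?N x \<le> dist_powr E (- \<alpha>) x * indicator {u<..<v} x"
    proof (cases "x \<in> ?N \<and> infdist x E \<noteq> 0")
      case True
      then have "\<kappa> powr - \<alpha> \<le> infdist x E powr - \<alpha>"
        using assms infdist_nonneg[of x E] by (intro powr_mono2') auto
      then show ?thesis using True assms by (auto simp: dist_powr_uminus intro!: ennreal_leI)
    qed (use assms in \<open>auto simp: dist_powr_uminus indicator_def\<close>)
  qed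
  finally show ?thesis .
qed

lemma chebyshev_infdist_powr:
  assumes "0 < \<beta>" "0 < \<kappa>"
  shows "ennreal (\<kappa> powr \<beta> * mass {x. \<kappa> \<le> infdist x E} u v) \<le>
    (\<integral>\<^sup>+x\<in>{u<..<v}. ennreal (infdist x E powr \<beta>) \<partial>lebesgue)"
proof -
  let ?N = "{x. \<kappa> \<le> infdist x E} \<inter> {u<..<v}"
  have N: "?N \<in> sets lebesgue" by (intro sets.Int infdist_level_sets) auto
  have "ennreal (\<kappa> powr \<beta> * mass {x. \<kappa> \<le> infdist x E} u v) = (\<integral>\<^sup>+x. ennreal (\<kappa> powr \<beta>) * indicator ?N x \<partial>lebesgue)"
    by (subst nn_integral_cmult_indicator[OF N], subst emeasure_Int_eq_mass)
      (auto simp: ennreal_mult)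
  also have "\<dots> \<le> (\<integral>\<^sup>+x\<in>{u<..<v}. ennreal (infdist x E powr \<beta>) \<partial>lebesgue)"
    by (rule nn_integral_mono) (use assms in \<open>auto simp: indicator_def intro!: ennreal_leI powr_mono2\<close>)
  finally show ?thesis .
qed

lemma has_pores_if_mass_near_small:
  assumes "E \<noteq> {}" "0 < \<kappa>" "\<kappa> \<le> v - u" "s < 1" "u < v"
    and "mass {x. infdist x E < \<kappa>} u v \<le> s * (v - u)"
  shows "has_pores E {u<..<v} \<kappa> ((1 - s) * (v - u))"
proof (rule has_pores_if_mass_far)
  show "(1 - s) * (v - u) \<le> mass {x. \<kappa> \<le> infdist x E} u v"
    using mass_far_eq[of u v \<kappa> E] assms by (simp add: algebra_simps)
qed (use assms in auto)

text \<open>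
  The porosity constant \<open>\<epsilon> / 2\<close> comes from Chebyshev's inequality, with a factor \<open>1 / 2\<close> because
  only lengths \<open>l\<close> below the supremum in the definition of the pore length are known to be admissible.
  If the pore length to the right vanishes, any positive length of the pores will do, and then
  the local integrability of the weight suffices.
\<close>

theorem right_median_porous_if_Ap_plus:
  assumes "E \<noteq> {}" "1 < p" "0 < \<alpha>" and w: "dist_powr E (- \<alpha>) \<in> Ap_plus p"
    and "0 < s" "s < 1" "t < 1"
  shows "right_median_porous s t E"
proof -
  let ?w = "dist_powr E (- \<alpha>)"
  define \<beta> where "\<beta> = \<alpha> / (p - 1)"
  have \<beta>: "0 < \<beta>" "\<beta> * (p - 1) = \<alpha>" using assms by (auto simp: \<beta>_def)
  define V where "V a b = average {a<..<b} (\<lambda>x. ennreal (infdist x E powr \<beta>))" for a b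
  have "(SUP (a, b) \<in> {(a, b). a < b}. average {a<..<(a + b) / 2} ?w * enn_powr (V ((a + b) / 2) b) (p - 1)) < \<infinity>"
    using w unfolding Ap_plus_def mem_Collect_eq enn_powr_dist_powr_dual[OF assms(3,2)] V_def \<beta>_def by simp
  then obtain C0 where C0: "0 \<le> C0" "(SUP (a, b) \<in> {(a, b). a < b}. average {a<..<(a + b) / 2} ?w * enn_powr (V ((a + b) / 2) b) (p - 1)) = ennreal C0"
    by (auto simp: less_top_ennreal)
  define C where "C = C0 + 1"
  have C: "0 < C" using C0 by (simp add: C_def)
  have Ap: "average {a<..<(a + b) / 2} ?w * enn_powr (V ((a + b) / 2) b) (p - 1) \<le> ennreal C" if "a < b" for a b
  proof -
    have "average {a<..<(a + b) / 2} ?w * enn_powr (V ((a + b) / 2) b) (p - 1) \<le> ennreal C0"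
      unfolding C0(2)[symmetric] by (rule SUP_upper2[of "(a, b)"]) (use that in auto)
    also have "\<dots> \<le> ennreal C" by (rule ennreal_leI) (simp add: C_def)
    finally show ?thesis .
  qed
  define D where "D = C * 4 powr \<alpha> / ((1 - t) / 2) powr (p - 1)"
  have D: "0 < D" using C \<open>t < 1\<close> by (simp add: D_def)
  define \<epsilon> where "\<epsilon> = min 1 ((s / D) powr (1 / \<alpha>))"
  have \<epsilon>: "0 < \<epsilon>" "\<epsilon> \<le> 1" using D \<open>0 < s\<close> by (auto simp: \<epsilon>_def)
  have "\<epsilon> powr \<alpha> \<le> ((s / D) powr (1 / \<alpha>)) powr \<alpha>"
    using \<epsilon> \<open>0 < \<alpha>\<close> by (intro powr_mono2) (auto simp: \<epsilon>_def)
  also have "\<dots> = s / D" using D \<open>0 < s\<close> \<open>0 < \<alpha>\<close> by (simp add: powr_powr)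
  finally have \<epsilon>D: "\<epsilon> powr \<alpha> * D \<le> s" using D by (simp add: pos_le_divide_eq)
  have "has_pores E {a<..<(a + b) / 2} (\<epsilon> / 2 * pore_length t E ((a + b) / 2) b) ((1 - s) * ((a + b) / 2 - a))"
    if "a < b" for a b
  proof -
    define v where "v = (a + b) / 2"
    define h where "h = v - a"
    have h: "0 < h" "v - a = h" "b - v = h" "a < v" "v < b" using \<open>a < b\<close> by (auto simp: h_def v_def field_simps)
    show ?thesis
    proof (cases "0 < pore_length t E v b")
      case True
      then obtain l where l: "pore_length t E v b / 2 < l" "has_pores E {v<..<b} l ((1 - t) * (b - v))"
        using less_pore_lengthD[of "pore_length t E v b / 2" t E v b] by auto
      have "0 < l" using l True by simp
      have "l \<le> h" using length_le_if_has_pores[OF l(2)] h by simp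
      have "(1 - 2 * (1 / 4)) * ((1 - t) * (b - v)) \<le> mass {x. 1 / 4 * l \<le> infdist x E} v b"
        by (rule mass_far_if_has_pores[OF assms(1) l(2) \<open>0 < l\<close>]) auto
      then have far: "(1 - t) / 2 * h \<le> mass {x. l / 4 \<le> infdist x E} v b" using h by simp
      define y where "y = (l / 4) powr \<beta> * ((1 - t) / 2)"
      have y: "0 < y" using \<open>0 < l\<close> \<open>t < 1\<close> by (simp add: y_def)
      have "y * h \<le> (l / 4) powr \<beta> * mass {x. l / 4 \<le> infdist x E} v b"
        using far unfolding y_def mult.assoc by (rule mult_left_mono) simp
      then have "ennreal (y * h) \<le> (\<integral>\<^sup>+x\<in>{v<..<b}. ennreal (infdist x E powr \<beta>) \<partial>lebesgue)"
        by (rule order_trans[OF ennreal_leI chebyshev_infdist_powr[OF \<beta>(1)]]) (use \<open>0 < l\<close> in simp)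
      then have "ennreal (y * h) / ennreal h \<le> V v b"
        unfolding V_def average_def using h by (simp add: divide_right_mono_ennreal)
      then have "ennreal y \<le> V v b" using h y by (simp add: divide_ennreal)
      then have Vy: "ennreal (y powr (p - 1)) \<le> enn_powr (V v b) (p - 1)"
        using enn_powr_mono[of "ennreal y" "V v b" "p - 1"] y assms by (simp add: enn_powr_ennreal)
      define N where "N = mass {x. infdist x E < \<epsilon> * l} a v"
      have "ennreal ((\<epsilon> * l) powr - \<alpha> * N) / ennreal h \<le> average {a<..<v} ?w"
        unfolding average_def N_def using chebyshev_dist_powr[OF \<open>0 < \<alpha>\<close>, of "\<epsilon> * l" E a v] h \<epsilon> \<open>0 < l\<close>
        by (simp add: divide_right_mono_ennreal)
      then have "ennreal ((\<epsilon> * l) powr - \<alpha> * N / h) \<le> average {a<..<v} ?w"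
        using h by (simp add: divide_ennreal N_def)
      then have "ennreal ((\<epsilon> * l) powr - \<alpha> * N / h) * ennreal (y powr (p - 1)) \<le>
          average {a<..<v} ?w * enn_powr (V v b) (p - 1)"
        by (rule mult_mono[OF _ Vy]) auto
      also have "\<dots> \<le> ennreal C" using Ap[OF \<open>a < b\<close>] unfolding v_def .
      finally have "ennreal ((\<epsilon> * l) powr - \<alpha> * N / h * y powr (p - 1)) \<le> ennreal C"
        by (subst ennreal_mult'') auto
      then have "(\<epsilon> * l) powr - \<alpha> * N / h * y powr (p - 1) \<le> C" using C by simp
      moreover have "y powr (p - 1) = l powr \<alpha> / 4 powr \<alpha> * ((1 - t) / 2) powr (p - 1)"
        using \<open>0 < l\<close> \<open>t < 1\<close> \<beta> by (simp add: y_def powr_mult powr_powr powr_divide)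
      ultimately have "N \<le> \<epsilon> powr \<alpha> * D * h"
        using \<open>0 < l\<close> \<epsilon> h \<open>t < 1\<close> by (simp add: D_def powr_mult powr_minus field_simps)
      also have "\<dots> \<le> s * h" using \<epsilon>D h by (intro mult_right_mono) auto
      finally have "N \<le> s * (v - a)" using h by simp
      moreover have "\<epsilon> * l \<le> v - a" using mult_mono[OF \<epsilon>(2) \<open>l \<le> h\<close>] \<open>0 < l\<close> h by simp
      ultimately have "has_pores E {a<..<v} (\<epsilon> * l) ((1 - s) * (v - a))"
        unfolding N_def using has_pores_if_mass_near_small[OF assms(1), of "\<epsilon> * l" v a s] \<epsilon> \<open>0 < l\<close> h \<open>s < 1\<close>
        by simp
      moreover have "\<epsilon> / 2 * pore_length t E v b \<le> \<epsilon> * l"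
        using mult_left_mono[OF less_imp_le[OF l(1)], of \<epsilon>] \<epsilon> by simp
      ultimately show ?thesis unfolding v_def[symmetric] by (rule has_pores_antimono)
    next
      case False
      then have L: "pore_length t E v b = 0" using pore_length_nonneg[of t E v b] by linarith
      have "(\<integral>\<^sup>+x\<in>{a<..<v}. ?w x \<partial>lebesgue) \<le> (\<integral>\<^sup>+x\<in>{a..v}. ?w x \<partial>lebesgue)"
        by (rule nn_integral_mono) (auto simp: indicator_def)
      also have "\<dots> < \<infinity>" using w by (auto simp: Ap_plus_def weight_def)
      finally obtain X where X: "0 \<le> X" "(\<integral>\<^sup>+x\<in>{a<..<v}. ?w x \<partial>lebesgue) = ennreal X"
        by (auto simp: less_top_ennreal)
      define \<kappa> where "\<kappa> = min h ((s * h / (X + 1)) powr (1 / \<alpha>))"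
      have \<kappa>: "0 < \<kappa>" "\<kappa> \<le> h" using X h \<open>0 < s\<close> by (auto simp: \<kappa>_def)
      have "\<kappa> powr \<alpha> \<le> ((s * h / (X + 1)) powr (1 / \<alpha>)) powr \<alpha>"
        using \<kappa> \<open>0 < \<alpha>\<close> by (intro powr_mono2) (auto simp: \<kappa>_def)
      also have "\<dots> = s * h / (X + 1)" using X \<open>0 < s\<close> \<open>0 < \<alpha>\<close> h by (simp add: powr_powr)
      finally have "\<kappa> powr \<alpha> * (X + 1) \<le> s * h" using X by (simp add: pos_le_divide_eq)
      moreover have "\<kappa> powr - \<alpha> * mass {x. infdist x E < \<kappa>} a v \<le> X"
        using chebyshev_dist_powr[OF \<open>0 < \<alpha>\<close> \<kappa>(1), of E a v] X by simp
      then have "mass {x. infdist x E < \<kappa>} a v \<le> \<kappa> powr \<alpha> * X"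
        using \<kappa> by (simp add: powr_minus field_simps)
      moreover have "\<kappa> powr \<alpha> * X \<le> \<kappa> powr \<alpha> * (X + 1)" by (intro mult_left_mono) auto
      ultimately have "mass {x. infdist x E < \<kappa>} a v \<le> s * (v - a)" using h by simp
      then have "has_pores E {a<..<v} \<kappa> ((1 - s) * (v - a))"
        using has_pores_if_mass_near_small[OF assms(1) \<kappa>(1), of v a s] \<kappa> h \<open>s < 1\<close> by simp
      then show ?thesis unfolding v_def[symmetric] L
        by (rule has_pores_antimono) (use \<kappa> in simp)
    qed
  qed
  then have "right_median_porous_const s t (\<epsilon> / 2) E"
    unfolding right_median_porous_const_def by blast
  then show ?thesis unfolding right_median_porous_def
    using \<epsilon> by (intro exI[of _ "\<epsilon> / 2"]) auto
qed

text \<open>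
  The gap between \<open>s\<close> and \<open>t\<close> is split in two: one half pays for the margins of the pores, the other
  one yields the decay rate \<open>\<sigma> / t < 1\<close>.
\<close>

theorem exists_dist_powr_in_Ap_plus_if_right_median_porous:
  assumes "E \<noteq> {}" "0 < s" "s < t" "t < 1" "right_median_porous s t E" "1 < p"
  shows "\<exists>\<alpha>>0. dist_powr E (- \<alpha>) \<in> Ap_plus p"
proof -
  define \<sigma> where "\<sigma> = (s + t) / 2"
  have \<sigma>: "0 < \<sigma>" "s < \<sigma>" "\<sigma> < t" using assms by (auto simp: \<sigma>_def)
  obtain c where c: "0 < c" "c \<le> 1 / 2"
    "\<And>\<rho> v r. 0 < \<rho> \<Longrightarrow> 0 < r \<Longrightarrow> mass {x. infdist x E < \<rho>} v (v + r) \<le> t * r \<Longrightarrow>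
      mass {x. infdist x E < c * \<rho>} (v - r) v \<le> \<sigma> * r"
    using mass_infdist_transfer[OF assms(1,5,2) \<sigma>(2)] \<sigma> assms by auto
  interpret distance_transfer E c \<sigma> t
  proof
    fix u r :: real assume "0 < r"
    then show "\<exists>\<rho>>0. mass {x. infdist x E < \<rho>} u (u + r) \<le> t * r"
      using mass_infdist_small[OF assms(1,5,3,4)] by metis
  qed (use assms c \<sigma> in auto)
  show ?thesis by (rule exists_dist_powr_in_Ap_plus[OF \<open>1 < p\<close>])
qed

theorem theorem1p4:
  fixes E :: "real set"
  assumes "E \<noteq> {}"
  shows
    "((\<exists>p \<alpha>. 1 < p \<and> 0 < \<alpha> \<and> dist_powr E (- \<alpha>) \<in> Ap_plus p) \<longleftrightarrow>
      (\<forall>p>1. \<exists>\<alpha>>0. dist_powr E (- \<alpha>) \<in> Ap_plus p)) \<and>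
     ((\<forall>p>1. \<exists>\<alpha>>0. dist_powr E (- \<alpha>) \<in> Ap_plus p) \<longleftrightarrow>
      (\<exists>s t. 0 < s \<and> s < t \<and> t < 1 \<and> right_median_porous s t E)) \<and>
     ((\<exists>s t. 0 < s \<and> s < t \<and> t < 1 \<and> right_median_porous s t E) \<longleftrightarrow>
      (\<forall>s t. 0 < s \<and> s < t \<and> t < 1 \<longrightarrow> right_median_porous s t E))"
  (is "(?a \<longleftrightarrow> ?b) \<and> (?b \<longleftrightarrow> ?c) \<and> (?c \<longleftrightarrow> ?d)")
proof -
  have "?a \<Longrightarrow> ?d"
    using right_median_porous_if_Ap_plus[OF assms] by (meson less_trans)
  moreover have "?d \<Longrightarrow> ?c"
    by (intro exI[of _ "1 / 4"] exI[of _ "1 / 2"]) auto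
  moreover have "?c \<Longrightarrow> ?b"
    using exists_dist_powr_in_Ap_plus_if_right_median_porous[OF assms] by blast
  moreover have "?b \<Longrightarrow> ?a"
    by (rule exI[of _ 2]) auto
  ultimately show ?thesis by blast
qed

end
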